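(* For every integer $n\ge1$ there exists a constant $C=C(n)$ such that the following holds. Let $r>0$ and let $u:B_{\sqrt{2n+1}\,r}\times[0,r^2]\to\mathbb{R}$ be a function whose graph flows by mean curvature. Then the area of the graph of $u(\cdot,r^2)$ over $B_{r/2}$ satisfies $$\int_{B_{r/2}}(1+|du|^2)^{1/2}(x,r^2)\,dx\le C\,r^n\,\bigl(1+r^{-1}\,\|u(\cdot,0)\|_\infty\bigr)^2 .$$
   Context: $B_s$ denotes the ball in $\mathbb{R}^n$ of radius $s$ centered at the origin. For a function $u=u(x,t)$, $du$ denotes the gradient in the $\mathbb{R}^n$-variable $x$, and $\operatorname{div}$ is the divergence in $\mathbb{R}^n$. The graph of $u$ flows by mean curvature if $u$ is smooth (the hypersurfaces $M_t=\{(x,y): y=u(x,t)\}\subset\mathbb{R}^{n+1}$ form a smooth one-parameter family) and $$u_t=(1+|du|^2)^{1/2}\,\operatorname{div}\left(\frac{du}{(1+|du|^2)^{1/2}}\right).$$ $\|u(\cdot,0)\|_\infty$ is the sup norm of $u(\cdot,0)$ on its domain $B_{\sqrt{2n+1}\,r}$. *)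

theory Defs
  imports "HOL-Analysis.Analysis"
begin

text \<open>
  \<open>k\<close>-fold continuous differentiability of \<open>f\<close> on \<open>S\<close>, with all derivatives taken within \<open>S\<close>.
  It is meant for sets such as \<open>\<Omega> \<times> {a..b}\<close> with \<open>\<Omega>\<close> open and \<open>a < b\<close>, on which
  the Frechet derivative within \<open>S\<close> is unique; at the end times \<open>a\<close> and \<open>b\<close> the derivatives
  in time are the one-sided ones, so that \<open>f\<close> is smooth up to the boundary in time.
\<close>

primrec Ck_on :: "nat \<Rightarrow> ('a::euclidean_space \<Rightarrow> 'b::real_normed_vector) \<Rightarrow> 'a set \<Rightarrow> bool" where
  "Ck_on 0 f S \<longleftrightarrow> continuous_on S f"
| "Ck_on (Suc k) f S \<longleftrightarrow>
     f differentiable_on S \<and> (\<forall>v. Ck_on k (\<lambda>x. frechet_derivative f (at x within S) v) S)"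

definition smooth_on :: "('a::euclidean_space \<Rightarrow> 'b::real_normed_vector) \<Rightarrow> 'a set \<Rightarrow> bool" where
  "smooth_on f S \<longleftrightarrow> (\<forall>k. Ck_on k f S)"

definition gradient :: "(real ^ 'n \<Rightarrow> real) \<Rightarrow> real ^ 'n \<Rightarrow> real ^ 'n" where
  "gradient f x = (\<chi> i. frechet_derivative f (at x) (axis i 1))"

definition divergence :: "(real ^ 'n \<Rightarrow> real ^ 'n) \<Rightarrow> real ^ 'n \<Rightarrow> real" where
  "divergence X x = (\<Sum>i\<in>UNIV. frechet_derivative X (at x) (axis i 1) $ i)"

definition area_element :: "(real ^ 'n \<Rightarrow> real) \<Rightarrow> real ^ 'n \<Rightarrow> real" where
  "area_element f x = sqrt (1 + (norm (gradient f x))\<^sup>2)"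

definition graph_flows_by_mean_curvature ::
    "(real ^ 'n) set \<Rightarrow> real set \<Rightarrow> (real ^ 'n \<Rightarrow> real \<Rightarrow> real) \<Rightarrow> bool" where
  "graph_flows_by_mean_curvature \<Omega> I u \<longleftrightarrow>
     smooth_on (\<lambda>(x, t). u x t) (\<Omega> \<times> I) \<and>
     (\<forall>x\<in>\<Omega>. \<forall>t\<in>I.
        ((\<lambda>s. u x s) has_real_derivative
           area_element (\<lambda>y. u y t) x *
           divergence (\<lambda>y. (1 / area_element (\<lambda>z. u z t) y) *\<^sub>R gradient (\<lambda>z. u z t) y) x)
          (at t within I))"

text \<open>The sup norm is extended-valued, since a function on an open ball may be unbounded.\<close>

definition sup_norm_on :: "'a set \<Rightarrow> ('a \<Rightarrow> real) \<Rightarrow> ennreal" where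
  "sup_norm_on S f = (SUP x\<in>S. ennreal \<bar>f x\<bar>)"

end

theory Submission
  imports Defs
begin

text \<open>
  Write \<open>W\<close> for the area element and \<open>L = \<partial>\<^sub>t - \<Sum>\<^sub>i\<^sub>j g\<^sup>i\<^sup>j \<partial>\<^sub>i\<partial>\<^sub>j\<close> with \<open>g\<^sup>i\<^sup>j = \<delta>\<^sub>i\<^sub>j - u\<^sub>i u\<^sub>j / W\<^sup>2\<close>, so that
  \<open>L u = 0\<close>. Since \<open>|x|\<^sup>2 + (u - c)\<^sup>2 + 2 n t\<close> is annihilated by \<open>L\<close> and is at least \<open>|x|\<^sup>2\<close>, the minimum
  principle with \<open>|c| = \<parallel>u(\<cdot>, 0)\<parallel> + R\<close>, where \<open>R\<^sup>2 = (2 n + 1) r\<^sup>2\<close>, gives \<open>|u| \<le> \<parallel>u(\<cdot>, 0)\<parallel> + R =: N\<close>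
  where \<open>|x|\<^sup>2 + 2 n t < R\<^sup>2\<close>.

  The cutoff \<open>\<zeta> = max 0 (\<rho>\<^sup>2 - |x|\<^sup>2 - 2 n t)\<close> satisfies \<open>L \<zeta>\<^sup>3 \<le> 0\<close>, hence
  \<open>(\<integral> \<zeta>\<^sup>3 W)' \<le> - \<integral> \<zeta>\<^sup>3 u\<^sub>t\<^sup>2 / W\<close>. On the other hand, testing \<open>u\<^sub>t / W = div (du / W)\<close> with \<open>\<zeta>\<^sup>3 u\<close> bounds
  \<open>\<integral> \<zeta>\<^sup>3 W\<close> by \<open>\<integral> \<zeta>\<^sup>3 + N \<integral> |d\<zeta>\<^sup>3| + N \<integral> \<zeta>\<^sup>3 |u\<^sub>t| / W\<close>. Weighting with \<open>t\<^sup>2\<close>, the last term is absorbed: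
  \<open>(t\<^sup>2 \<integral> \<zeta>\<^sup>3 W)' \<le> 2 t (\<integral> \<zeta>\<^sup>3 + N \<integral> |d\<zeta>\<^sup>3|) + N\<^sup>2 \<integral> \<zeta>\<^sup>3\<close>, independently of the initial area.
  Integrating up to \<open>t = r\<^sup>2\<close> with \<open>\<rho>\<^sup>2 = (2 n + 1/2) r\<^sup>2\<close> gives the claim.
\<close>

subsection \<open>Calculus\<close>

lemma line_derivative_shift:
  fixes F :: "'a::real_normed_vector \<Rightarrow> real"
  assumes "((\<lambda>s. F ((z + s0 *\<^sub>R v) + s *\<^sub>R v)) has_real_derivative d) (at 0)"
  shows "((\<lambda>s. F (z + s *\<^sub>R v)) has_real_derivative d) (at s0)"
proof -
  have "((\<lambda>s. F (z + (s + s0) *\<^sub>R v)) has_real_derivative d) (at 0)"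
    using assms by (simp add: algebra_simps)
  then show ?thesis
    using DERIV_shift[of "\<lambda>s. F (z + s *\<^sub>R v)" d 0 s0] by simp
qed

text \<open>Apply the mean value theorem twice to the second difference over a parallelogram with
  sides \<open>h v\<close> and \<open>h w\<close>: first along \<open>v\<close>, then along
  \<open>w\<close>.\<close>

lemma mixed_difference_mvt:
  fixes F :: "'a::real_normed_vector \<Rightarrow> real"
  assumes 1: "\<And>y. y \<in> S \<Longrightarrow> ((\<lambda>s. F (y + s *\<^sub>R v)) has_real_derivative Fv y) (at 0)"
    and 2: "\<And>y. y \<in> S \<Longrightarrow> ((\<lambda>s. Fv (y + s *\<^sub>R w)) has_real_derivative Fvw y) (at 0)"
    and h: "0 < h"
    and S: "\<And>s t. 0 \<le> s \<Longrightarrow> s \<le> h \<Longrightarrow> 0 \<le> t \<Longrightarrow> t \<le> h \<Longrightarrow> x + s *\<^sub>R v + t *\<^sub>R w \<in> S"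
  shows "\<exists>s t. 0 \<le> s \<and> s \<le> h \<and> 0 \<le> t \<and> t \<le> h \<and>
    F (x + h *\<^sub>R v + h *\<^sub>R w) - F (x + h *\<^sub>R v) - F (x + h *\<^sub>R w) + F x
      = h\<^sup>2 * Fvw (x + s *\<^sub>R v + t *\<^sub>R w)"
proof -
  \<comment> \<open>\<open>g\<close> is the increment of \<open>F\<close> across the side
    \<open>h w\<close>, so the second difference is \<open>g h - g 0\<close>.\<close>
  define g where "g s = F ((x + h *\<^sub>R w) + s *\<^sub>R v) - F (x + s *\<^sub>R v)" for s
  have g: "(g has_real_derivative (Fv ((x + h *\<^sub>R w) + s *\<^sub>R v) - Fv (x + s *\<^sub>R v))) (at s)"
    if "0 \<le> s" "s \<le> h" for s
  proof -
    have "x + s *\<^sub>R v + h *\<^sub>R w \<in> S" "x + s *\<^sub>R v \<in> S"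
      using S[of s h] S[of s 0] that h by simp_all
    moreover have "(x + h *\<^sub>R w) + s *\<^sub>R v = x + s *\<^sub>R v + h *\<^sub>R w"
      by (simp add: ac_simps)
    ultimately have "(x + h *\<^sub>R w) + s *\<^sub>R v \<in> S" "x + s *\<^sub>R v \<in> S"
      by metis+
    then show ?thesis
      unfolding g_def by (intro DERIV_diff line_derivative_shift[OF 1])
  qed
  obtain s where s: "0 < s" "s < h"
    and gs: "g h - g 0 = (h - 0) * (Fv ((x + h *\<^sub>R w) + s *\<^sub>R v) - Fv (x + s *\<^sub>R v))"
    using MVT2[of 0 h g, OF h g] by blast
  have k: "((\<lambda>t. Fv ((x + s *\<^sub>R v) + t *\<^sub>R w)) has_real_derivative
      Fvw ((x + s *\<^sub>R v) + t *\<^sub>R w)) (at t)" if "0 \<le> t" "t \<le> h" for t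
    using S[of s t] s that by (intro line_derivative_shift[OF 2]) auto
  obtain t where t: "0 < t" "t < h"
    and kt: "Fv ((x + s *\<^sub>R v) + h *\<^sub>R w) - Fv ((x + s *\<^sub>R v) + 0 *\<^sub>R w)
      = (h - 0) * Fvw ((x + s *\<^sub>R v) + t *\<^sub>R w)"
    using MVT2[of 0 h, OF h k] by blast
  have "F (x + h *\<^sub>R v + h *\<^sub>R w) - F (x + h *\<^sub>R v) - F (x + h *\<^sub>R w) + F x = g h - g 0"
    by (simp add: g_def algebra_simps)
  also have "\<dots> = h\<^sup>2 * Fvw (x + s *\<^sub>R v + t *\<^sub>R w)"
    using gs kt by (simp add: algebra_simps power2_eq_square)
  finally show ?thesis
    using s t by (intro exI[of _ s] exI[of _ t]) auto
qed

text \<open>The second difference is symmetric in \<open>v\<close> and \<open>w\<close>, so it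
  equals \<open>h^2 Fvw\<close> at one point near \<open>x\<close> and \<open>h^2 Fwv\<close> at
  another; continuity forces equality at \<open>x\<close>. Directional derivatives are used so that
  space and time directions can be mixed.\<close>

lemma mixed_derivatives_commute:
  fixes F :: "'a::real_normed_vector \<Rightarrow> real"
  assumes S: "open S" "x \<in> S"
    and Fv: "\<And>y. y \<in> S \<Longrightarrow> ((\<lambda>s. F (y + s *\<^sub>R v)) has_real_derivative Fv y) (at 0)"
    and Fw: "\<And>y. y \<in> S \<Longrightarrow> ((\<lambda>s. F (y + s *\<^sub>R w)) has_real_derivative Fw y) (at 0)"
    and Fvw: "\<And>y. y \<in> S \<Longrightarrow> ((\<lambda>s. Fv (y + s *\<^sub>R w)) has_real_derivative Fvw y) (at 0)"
    and Fwv: "\<And>y. y \<in> S \<Longrightarrow> ((\<lambda>s. Fw (y + s *\<^sub>R v)) has_real_derivative Fwv y) (at 0)"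
    and cont: "continuous_on S Fvw" "continuous_on S Fwv"
  shows "Fvw x = Fwv x"
proof (rule ccontr)
  assume "Fvw x \<noteq> Fwv x"
  define e where "e = \<bar>Fvw x - Fwv x\<bar> / 2"
  have e: "e > 0" using \<open>Fvw x \<noteq> Fwv x\<close> by (simp add: e_def)
  obtain d0 where d0: "d0 > 0" "ball x d0 \<subseteq> S"
    using S by (auto simp: open_contains_ball)
  have "continuous (at x) Fvw" "continuous (at x) Fwv"
    using cont S by (auto simp: continuous_on_eq_continuous_at)
  then obtain d1 d2 where d1: "d1 > 0" "\<And>y. dist y x < d1 \<Longrightarrow> dist (Fvw y) (Fvw x) < e"
    and d2: "d2 > 0" "\<And>y. dist y x < d2 \<Longrightarrow> dist (Fwv y) (Fwv x) < e"
    using e unfolding continuous_at_eps_delta by (elim allE[of _ e]) blast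
  define d where "d = min d0 (min d1 d2)"
  \<comment> \<open>\<open>k\<close> bounds \<open>norm v + norm w\<close> and is positive even if
    both vanish; with \<open>h = d / (2 * k)\<close> the parallelogram stays within
    \<open>d / 2\<close> of \<open>x\<close>.\<close>
  define k where "k = norm v + norm w + 1"
  define h where "h = d / (2 * k)"
  have d: "d > 0" using d0 d1 d2 by (simp add: d_def)
  have pos: "k > 0"
    unfolding k_def by (smt (verit) norm_ge_zero)
  have h: "h > 0" using d pos by (simp add: h_def)
  have near: "dist (x + s *\<^sub>R v + t *\<^sub>R w) x < d"
    if "0 \<le> s" "s \<le> h" "0 \<le> t" "t \<le> h" for s t
  proof -
    have "norm (s *\<^sub>R v + t *\<^sub>R w) \<le> s * norm v + t * norm w"
      using that norm_triangle_ineq[of "s *\<^sub>R v" "t *\<^sub>R w"] by simp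
    also have "\<dots> \<le> h * norm v + h * norm w"
      using that by (intro add_mono mult_right_mono) auto
    also have "\<dots> \<le> h * k"
      using h by (simp add: k_def algebra_simps)
    also have "\<dots> = d / 2" using pos by (simp add: h_def)
    finally show ?thesis using d by (simp add: dist_norm add.assoc)
  qed
  have near': "dist (x + s *\<^sub>R w + t *\<^sub>R v) x < d"
    if "0 \<le> s" "s \<le> h" "0 \<le> t" "t \<le> h" for s t
    using near[OF that(3,4,1,2)] by (simp add: ac_simps)
  have sub: "y \<in> S" if "dist y x < d" for y
    using that d0 by (auto simp: d_def subset_eq dist_commute)
  obtain s t where st: "0 \<le> s" "s \<le> h" "0 \<le> t" "t \<le> h"
    "F (x + h *\<^sub>R v + h *\<^sub>R w) - F (x + h *\<^sub>R v) - F (x + h *\<^sub>R w) + F x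
      = h\<^sup>2 * Fvw (x + s *\<^sub>R v + t *\<^sub>R w)"
    using mixed_difference_mvt[OF Fv Fvw h sub, OF _ _ near] by blast
  obtain s' t' where st': "0 \<le> s'" "s' \<le> h" "0 \<le> t'" "t' \<le> h"
    "F (x + h *\<^sub>R w + h *\<^sub>R v) - F (x + h *\<^sub>R w) - F (x + h *\<^sub>R v) + F x
      = h\<^sup>2 * Fwv (x + s' *\<^sub>R w + t' *\<^sub>R v)"
    using mixed_difference_mvt[OF Fw Fwv h sub, OF _ _ near'] by blast
  have swap: "x + h *\<^sub>R w + h *\<^sub>R v = x + h *\<^sub>R v + h *\<^sub>R w"
    by (simp add: ac_simps)
  have "h\<^sup>2 * Fvw (x + s *\<^sub>R v + t *\<^sub>R w) = h\<^sup>2 * Fwv (x + s' *\<^sub>R w + t' *\<^sub>R v)"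
    using st(5) st'(5)[unfolded swap] by linarith
  then have "Fvw (x + s *\<^sub>R v + t *\<^sub>R w) = Fwv (x + s' *\<^sub>R w + t' *\<^sub>R v)"
    using h by simp
  moreover have "dist (Fvw (x + s *\<^sub>R v + t *\<^sub>R w)) (Fvw x) < e"
    using near[OF st(1-4)] by (intro d1) (simp add: d_def)
  moreover have "dist (Fwv (x + s' *\<^sub>R w + t' *\<^sub>R v)) (Fwv x) < e"
    using near'[OF st'(1-4)] by (intro d2) (simp add: d_def)
  ultimately show False
    unfolding e_def dist_real_def by (smt (verit) field_sum_of_halves)
qed

section \<open>Second-order conditions for the minimum principle\<close>

text \<open>At the minimum \<open>g' 0 = 0\<close>; if \<open>c < 0\<close>, then \<open>g'\<close>
  is negative just to the right of 0, and \<open>g\<close> would drop below \<open>g 0\<close>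
  there.\<close>

lemma local_min_second_derivative_nonneg:
  fixes g g' :: "real \<Rightarrow> real"
  assumes d: "d > 0"
    and g: "\<And>s. \<bar>s\<bar> < d \<Longrightarrow> (g has_real_derivative g' s) (at s)"
    and g': "(g' has_real_derivative c) (at 0)"
    and min: "\<And>s. \<bar>s\<bar> < d \<Longrightarrow> g 0 \<le> g s"
  shows "c \<ge> 0"
proof (rule ccontr)
  assume "\<not> c \<ge> 0"
  then obtain e where e: "e > 0" "\<And>h. 0 < h \<Longrightarrow> h < e \<Longrightarrow> g' (0 + h) < g' 0"
    using DERIV_neg_dec_right[OF g'] by auto
  have 0: "g' 0 = 0"
    using DERIV_local_min[OF g[of 0] d] min d by auto
  define m where "m = min d e / 2"
  have m: "0 < m" "m < d" "m < e" using d e by (auto simp: m_def)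
  obtain z where z: "0 < z" "z < m" "g m - g 0 = (m - 0) * g' z"
    using MVT2[of 0 m g g', OF m(1) g] m by force
  have "g' z < 0" using e(2)[of z] z m 0 by simp
  then have "m * g' z < 0" using m by (intro mult_pos_neg)
  then have "g m < g 0" using z by simp
  then show False using min[of m] m by simp
qed

text \<open>With \<open>\<beta> = 1 / (W\<^sup>2 + W)\<close> and \<open>W\<^sup>2 = 1 + |p|\<^sup>2\<close>, the matrix \<open>I - p p\<^sup>T / W\<^sup>2\<close> is the square
  of \<open>I - \<beta> p p\<^sup>T\<close>, so the trace is a sum of values of the quadratic form.\<close>

lemma graph_trace_nonneg:
  fixes H :: "real^'n^'n" and p :: "real^'n"
  assumes psd: "\<And>v. 0 \<le> v \<bullet> (H *v v)"
  shows "0 \<le> trace H - (p \<bullet> (H *v p)) / (1 + p \<bullet> p)"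
proof -
  define W where "W = sqrt (1 + p \<bullet> p)"
  have W2: "W\<^sup>2 = 1 + p \<bullet> p" by (simp add: W_def add_nonneg_nonneg)
  have W: "W \<ge> 1" by (simp add: W_def)
  have W': "W + W * W > 0" using W by (simp add: add_pos_pos)
  define b where "b = 1 / (W\<^sup>2 + W)"
  have b: "2 * b - b\<^sup>2 * (p \<bullet> p) = 1 / (1 + p \<bullet> p)"
  proof -
    have "p \<bullet> p = W\<^sup>2 - 1" using W2 by simp
    then have "b * (p \<bullet> p) = (W - 1) / W"
      using W W' unfolding b_def
      by (simp add: divide_simps power2_eq_square) (simp add: algebra_simps)
    then have "2 * b - b\<^sup>2 * (p \<bullet> p) = b * (2 - (W - 1) / W)"
      by (simp add: power2_eq_square algebra_simps)
    also have "\<dots> = 1 / W\<^sup>2"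
      using W W' unfolding b_def by (simp add: divide_simps power2_eq_square) (simp add: algebra_simps)
    finally show ?thesis using W2 by simp
  qed
  \<comment> \<open>\<open>Q k\<close> is column \<open>k\<close> of the square root
    \<open>I - b p p^T\<close>.\<close>
  define Q where "Q k = axis k 1 - (b * p $ k) *\<^sub>R p" for k
  have "Q k \<bullet> (H *v Q k) = H $ k $ k - b * (p $ k * (H *v p) $ k)
      - b * (p $ k * (p \<bullet> column k H)) + b\<^sup>2 * (p $ k * p $ k) * (p \<bullet> (H *v p))" for k
  proof -
    have "H *v Q k = column k H - (b * p $ k) *\<^sub>R (H *v p)"
      unfolding Q_def by (simp add: matrix_vector_mult_diff_distrib matrix_vector_mult_scaleR
        matrix_vector_mul_component matrix_vector_mult_basis)
    then show ?thesis
      unfolding Q_def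
      by (simp add: inner_diff_left inner_diff_right inner_axis' column_def power2_eq_square algebra_simps)
  qed
  then have "(\<Sum>k\<in>UNIV. Q k \<bullet> (H *v Q k)) = (\<Sum>k\<in>UNIV. H $ k $ k)
      - b * (\<Sum>k\<in>UNIV. p $ k * (H *v p) $ k) - b * (\<Sum>k\<in>UNIV. p $ k * (p \<bullet> column k H))
      + b\<^sup>2 * (\<Sum>k\<in>UNIV. p $ k * p $ k) * (p \<bullet> (H *v p))"
    by (simp add: sum.distrib sum_subtractf sum_distrib_left sum_distrib_right)
  also have "(\<Sum>k\<in>UNIV. p $ k * p $ k) = p \<bullet> p"
    by (simp add: inner_vec_def)
  also have "(\<Sum>k\<in>UNIV. p $ k * (H *v p) $ k) = p \<bullet> (H *v p)"
    by (simp add: inner_vec_def)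
  also have "(\<Sum>k\<in>UNIV. H $ k $ k) = trace H"
    by (simp add: trace_def)
  also have "(\<Sum>k\<in>UNIV. p $ k * (p \<bullet> column k H)) = p \<bullet> (H *v p)"
    unfolding inner_vec_def matrix_vector_mult_def column_def
    by (simp add: sum_distrib_left) (subst sum.swap, simp add: ac_simps)
  also have "trace H - b * (p \<bullet> (H *v p)) - b * (p \<bullet> (H *v p)) + b\<^sup>2 * (p \<bullet> p) * (p \<bullet> (H *v p))
      = trace H - (2 * b - b\<^sup>2 * (p \<bullet> p)) * (p \<bullet> (H *v p))"
    by (simp add: algebra_simps)
  also have "\<dots> = trace H - (p \<bullet> (H *v p)) / (1 + p \<bullet> p)"
    by (simp add: b)
  finally show ?thesis
    using sum_nonneg[of UNIV "\<lambda>k. Q k \<bullet> (H *v Q k)"] psd by simp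
qed

section \<open>Integrals of compactly supported derivatives\<close>

text \<open>Differentiate the constant \<open>h \<mapsto> \<integral> f (x + h v) dx\<close> at \<open>h = 0\<close>.\<close>

lemma integral_directional_derivative_zero:
  fixes f D :: "'a::euclidean_space \<Rightarrow> real"
  assumes f: "\<And>x. ((\<lambda>s. f (x + s *\<^sub>R v)) has_real_derivative D x) (at 0)"
    and f_cont: "continuous_on UNIV f" and D: "continuous_on UNIV D"
    and supp: "\<And>x. x \<notin> cbox a b \<Longrightarrow> f x = 0" "\<And>x. x \<notin> cbox a b \<Longrightarrow> D x = 0"
  shows "integral (cbox a b) D = 0"
proof -
  \<comment> \<open>The larger box contains the support shifted by \<open>- s v\<close> for all
    \<open>s\<close> in \<open>[-1, 1]\<close>, so the integral of each translate over this fixed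
    box is the full integral.\<close>
  obtain a' b' where ab': "(\<lambda>(x, s). x - s *\<^sub>R v) ` (cbox a b \<times> {-1..1}) \<subseteq> cbox a' b'"
  proof -
    have "compact ((\<lambda>(x, s). x - s *\<^sub>R v) ` (cbox a b \<times> {-1..1::real}))"
      by (intro compact_continuous_image compact_Times) (auto intro!: continuous_intros simp: split_beta)
    then have "bounded ((\<lambda>(x, s). x - s *\<^sub>R v) ` (cbox a b \<times> {-1..1::real}))"
      by (rule compact_imp_bounded)
    then obtain c where "(\<lambda>(x, s). x - s *\<^sub>R v) ` (cbox a b \<times> {-1..1::real}) \<subseteq> cbox (- c) c"
      by (rule bounded_subset_cbox_symmetric)
    then show ?thesis by (rule that)
  qed
  have superset: "integral (cbox a'' b'') g = integral (cbox a b) g"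
    if "continuous_on UNIV g" "\<And>x. x \<notin> cbox a b \<Longrightarrow> g x = 0" "cbox a b \<subseteq> cbox a'' b''"
    for g :: "'a \<Rightarrow> real" and a'' b''
  proof -
    have "(g has_integral integral (cbox a b) g) (cbox a b)"
      using that(1) by (intro integrable_integral integrable_continuous continuous_on_subset[OF that(1)]) auto
    from has_integral_on_superset[OF this that(2,3)] show ?thesis
      by (rule integral_unique)
  qed
  have const: "integral (cbox a' b') (\<lambda>x. f (x + s *\<^sub>R v)) = integral (cbox a b) f"
    if "s \<in> {-1..1}" for s
  proof -
    have "y \<in> cbox (a' + s *\<^sub>R v) (b' + s *\<^sub>R v)" if "y \<in> cbox a b" for y
    proof -
      have "(\<lambda>(x, s). x - s *\<^sub>R v) (y, s) \<in> cbox a' b'"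
        using ab' \<open>s \<in> {-1..1}\<close> that by blast
      then show ?thesis by (simp add: mem_box inner_simps algebra_simps)
    qed
    then have "integral (cbox (a' + s *\<^sub>R v) (b' + s *\<^sub>R v)) f = integral (cbox a b) f"
      by (intro superset f_cont supp) auto
    then show ?thesis
      using integral_shift_cbox_plus[of a' b' f "s *\<^sub>R v"] by (simp add: o_def add.commute)
  qed
  have "((\<lambda>s. integral (cbox a' b') (\<lambda>x. f (x + s *\<^sub>R v))) has_real_derivative
      integral (cbox a' b') (\<lambda>x. D (x + 0 *\<^sub>R v))) (at 0 within {-1..1})"
  proof (rule leibniz_rule_field_derivative[where fx="\<lambda>s x. D (x + s *\<^sub>R v)"])
    show "((\<lambda>s. f (x + s *\<^sub>R v)) has_real_derivative D (x + s *\<^sub>R v)) (at s within {-1..1})" for s x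
      by (rule has_field_derivative_at_within[OF line_derivative_shift[OF f]])
    show "(\<lambda>x. f (x + s *\<^sub>R v)) integrable_on cbox a' b'" for s
      by (intro integrable_continuous continuous_on_compose2[OF f_cont] continuous_intros) auto
    show "continuous_on ({-1..1} \<times> cbox a' b') (\<lambda>(s, x). D (x + s *\<^sub>R v))"
      unfolding split_beta
      by (intro continuous_on_compose2[OF D] continuous_intros) auto
  qed auto
  then have "((\<lambda>s. integral (cbox a b) f) has_real_derivative
      integral (cbox a' b') (\<lambda>x. D (x + 0 *\<^sub>R v))) (at 0 within {-1..1})"
    by (rule has_field_derivative_transform_within[of _ _ _ _ 1]) (auto simp: const)
  then have "((\<lambda>s. integral (cbox a b) f) has_real_derivative
      integral (cbox a' b') (\<lambda>x. D (x + 0 *\<^sub>R v))) (at 0)"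
    using at_within_Icc_at[of "-1" 0 "1::real"] by simp
  from DERIV_unique[OF this DERIV_const] have "integral (cbox a' b') D = 0"
    by simp
  moreover have "cbox a b \<subseteq> cbox a' b'"
  proof
    fix x assume "x \<in> cbox a b"
    then have "(\<lambda>(x, s). x - s *\<^sub>R v) (x, 0::real) \<in> cbox a' b'"
      using ab' by (intro subsetD[OF ab'] imageI) auto
    then show "x \<in> cbox a' b'" by simp
  qed
  then have "integral (cbox a' b') D = integral (cbox a b) D"
    by (intro superset D supp)
  ultimately show ?thesis by simp
qed

subsection \<open>Derivatives of the flow\<close>

text \<open>As \<Omega> is open, freezing the time gives a full derivative in space, even at the end
  times, where the space-time derivative is one-sided.\<close>

lemma has_derivative_slice_space:
  fixes F :: "'a::real_normed_vector \<times> real \<Rightarrow> 'b::real_normed_vector"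
  assumes "(F has_derivative F') (at (x, t) within \<Omega> \<times> I)" "open \<Omega>" "x \<in> \<Omega>" "t \<in> I"
  shows "((\<lambda>y. F (y, t)) has_derivative (\<lambda>h. F' (h, 0))) (at x)"
proof -
  have "(F has_derivative F') (at (x, t) within (\<lambda>y. (y, t)) ` \<Omega>)"
    using assms by (intro has_derivative_subset[OF assms(1)]) auto
  then have "((\<lambda>y. F (y, t)) has_derivative (\<lambda>h. F' (h, 0))) (at x within \<Omega>)"
    by (rule has_derivative_in_compose[rotated]) (auto intro!: derivative_eq_intros)
  then show ?thesis by (simp only: at_within_open[OF assms(3,2)])
qed

lemma has_derivative_slice_time:
  fixes F :: "'a::real_normed_vector \<times> real \<Rightarrow> 'b::real_normed_vector"
  assumes F: "(F has_derivative F') (at (x, t) within \<Omega> \<times> I)" and "x \<in> \<Omega>" "t \<in> I"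
  shows "((\<lambda>\<tau>. F (x, \<tau>)) has_vector_derivative F' (0, 1)) (at t within I)"
proof -
  have "(F has_derivative F') (at (x, t) within (\<lambda>\<tau>. (x, \<tau>)) ` I)"
    using assms by (intro has_derivative_subset[OF assms(1)]) auto
  then have "((\<lambda>\<tau>. F (x, \<tau>)) has_derivative (\<lambda>h. F' (0, h))) (at t within I)"
    by (rule has_derivative_in_compose[rotated]) (auto intro!: derivative_eq_intros)
  moreover have "(\<lambda>h. F' (0, h)) = (\<lambda>h. h *\<^sub>R F' (0, 1))"
  proof
    show "F' (0, h) = h *\<^sub>R F' (0, 1)" for h
      using linear_scale[OF has_derivative_linear[OF F], of h "(0, 1)"] by simp
  qed
  ultimately show ?thesis by (simp only: has_vector_derivative_def)
qed

lemma linear_real_vec_expansion: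
  fixes f :: "real^'n \<Rightarrow> real"
  assumes "linear f"
  shows "f h = (\<chi> i. f (axis i 1)) \<bullet> h"
proof -
  have "f h = f (\<Sum>i\<in>UNIV. h $ i *\<^sub>R axis i 1)"
    by (rule arg_cong[of _ _ f]) (simp add: basis_expansion flip: scalar_mult_eq_scaleR)
  also have "\<dots> = (\<Sum>i\<in>UNIV. h $ i * f (axis i 1))"
    by (simp add: linear_sum[OF assms] linear_scale[OF assms])
  finally show ?thesis by (simp add: inner_vec_def mult.commute)
qed

lemma has_derivative_vec_componentwise:
  fixes f :: "'a::real_normed_vector \<Rightarrow> real^'n"
  assumes "\<And>i. ((\<lambda>y. f y $ i) has_derivative (\<lambda>h. f' h $ i)) (at x within S)"
  shows "(f has_derivative f') (at x within S)"
  using assms unfolding has_derivative_componentwise_within[of f]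
  by (auto simp: Basis_vec_def inner_axis)

text \<open>In the usual notation \<open>p = du\<close>, \<open>q = u_t\<close>, \<open>P\<close> is
  the Hessian of \<open>u\<close> and \<open>s = du_t\<close>; \<open>evolution\<close> is the flow
  equation in nondivergence form. The facts \<open>q_x\<close> and \<open>P_sym\<close> express
  equality of mixed derivatives and are stated for interior times, where space-time is open.\<close>

locale graph_flow =
  fixes \<Omega> :: "(real^'n) set" and T :: real and u :: "real^'n \<Rightarrow> real \<Rightarrow> real"
    and p :: "real^'n \<Rightarrow> real \<Rightarrow> real^'n" and q :: "real^'n \<Rightarrow> real \<Rightarrow> real"
    and P :: "real^'n \<Rightarrow> real \<Rightarrow> real^'n^'n" and s :: "real^'n \<Rightarrow> real \<Rightarrow> real^'n"
  assumes open_domain: "open \<Omega>" and T_pos: "0 < T"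
    and u_x: "\<And>x t. x \<in> \<Omega> \<Longrightarrow> t \<in> {0..T} \<Longrightarrow> ((\<lambda>y. u y t) has_derivative (\<lambda>h. p x t \<bullet> h)) (at x)"
    and u_t: "\<And>x t. x \<in> \<Omega> \<Longrightarrow> t \<in> {0..T} \<Longrightarrow>
      ((\<lambda>\<tau>. u x \<tau>) has_real_derivative q x t) (at t within {0..T})"
    and p_x: "\<And>x t. x \<in> \<Omega> \<Longrightarrow> t \<in> {0..T} \<Longrightarrow> ((\<lambda>y. p y t) has_derivative (\<lambda>h. P x t *v h)) (at x)"
    and p_t: "\<And>x t. x \<in> \<Omega> \<Longrightarrow> t \<in> {0..T} \<Longrightarrow>
      ((\<lambda>\<tau>. p x \<tau>) has_vector_derivative s x t) (at t within {0..T})"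
    and q_x: "\<And>x t. x \<in> \<Omega> \<Longrightarrow> t \<in> {0<..<T} \<Longrightarrow> ((\<lambda>y. q y t) has_derivative (\<lambda>h. s x t \<bullet> h)) (at x)"
    and P_sym: "\<And>x t. x \<in> \<Omega> \<Longrightarrow> t \<in> {0<..<T} \<Longrightarrow> transpose (P x t) = P x t"
    and evolution: "\<And>x t. x \<in> \<Omega> \<Longrightarrow> t \<in> {0..T} \<Longrightarrow>
      q x t = trace (P x t) - (p x t \<bullet> (P x t *v p x t)) / (1 + p x t \<bullet> p x t)"
    and u_cont: "continuous_on (\<Omega> \<times> {0..T}) (\<lambda>(x, t). u x t)"
    and p_cont: "continuous_on (\<Omega> \<times> {0..T}) (\<lambda>(x, t). p x t)"
    and q_cont: "continuous_on (\<Omega> \<times> {0..T}) (\<lambda>(x, t). q x t)"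
    and P_cont: "continuous_on (\<Omega> \<times> {0..T}) (\<lambda>(x, t). P x t)"
    and s_cont: "continuous_on (\<Omega> \<times> {0..T}) (\<lambda>(x, t). s x t)"

section \<open>The mean curvature operator in nondivergence form\<close>

lemma gradient_eqI:
  assumes "(f has_derivative (\<lambda>h. g \<bullet> h)) (at x)"
  shows "gradient f x = g"
  using frechet_derivative_at[OF assms, symmetric]
  by (simp add: gradient_def inner_axis vec_eq_iff)

lemma area_element_eqI:
  assumes "(f has_derivative (\<lambda>h. g \<bullet> h)) (at x)"
  shows "area_element f x = sqrt (1 + g \<bullet> g)"
  by (simp add: area_element_def gradient_eqI[OF assms] power2_norm_eq_inner)

lemma has_derivative_area:
  fixes p :: "real^'n \<Rightarrow> real^'n"
  assumes p: "(p has_derivative (\<lambda>h. P *v h)) (at x)"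
    and W: "\<And>y. W y = sqrt (1 + p y \<bullet> p y)"
  shows "(W has_derivative (\<lambda>h. (p x \<bullet> (P *v h)) / W x)) (at x)"
    and "((\<lambda>y. 1 / W y) has_derivative (\<lambda>h. - (p x \<bullet> (P *v h)) / (W x)^3)) (at x)"
proof -
  have pos: "1 + p x \<bullet> p x > 0" by (simp add: add_pos_nonneg)
  have "((\<lambda>y. sqrt (1 + p y \<bullet> p y)) has_derivative (\<lambda>h. (p x \<bullet> (P *v h)) / W x)) (at x)"
    unfolding W using pos
    by (auto intro!: derivative_eq_intros p simp: inner_commute field_simps)
  then show W': "(W has_derivative (\<lambda>h. (p x \<bullet> (P *v h)) / W x)) (at x)"
    by (simp flip: W)
  have "W x > 0" using pos by (simp add: W)
  then show "((\<lambda>y. 1 / W y) has_derivative (\<lambda>h. - (p x \<bullet> (P *v h)) / (W x)^3)) (at x)"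
    by (auto intro!: derivative_eq_intros W' simp: field_simps power3_eq_cube)
qed

text \<open>Product rule for \<open>p / W\<close>. Summing the diagonal turns the second term into
  the quadratic form \<open>p \<bullet> (P *v p)\<close> divided by \<open>W^3\<close>; multiplying
  the result by \<open>W\<close> gives the right-hand side of the flow equation.\<close>

lemma divergence_unit_normal:
  fixes p :: "real^'n \<Rightarrow> real^'n"
  assumes p: "(p has_derivative (\<lambda>h. P *v h)) (at x)"
    and W: "\<And>y. W y = sqrt (1 + p y \<bullet> p y)"
  shows "((\<lambda>y. (1 / W y) *\<^sub>R p y) has_derivative
      (\<lambda>h. (1 / W x) *\<^sub>R (P *v h) - ((p x \<bullet> (P *v h)) / (W x)^3) *\<^sub>R p x)) (at x)"
    and "(\<Sum>i\<in>UNIV. ((1 / W x) *\<^sub>R (P *v axis i 1) - ((p x \<bullet> (P *v axis i 1)) / (W x)^3) *\<^sub>R p x) $ i)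
      = (trace P - (p x \<bullet> (P *v p x)) / (1 + p x \<bullet> p x)) / W x"
proof -
  show "((\<lambda>y. (1 / W y) *\<^sub>R p y) has_derivative
      (\<lambda>h. (1 / W x) *\<^sub>R (P *v h) - ((p x \<bullet> (P *v h)) / (W x)^3) *\<^sub>R p x)) (at x)"
    by (rule has_derivative_eq_rhs[OF has_derivative_scaleR[OF has_derivative_area(2)[OF p W] p]]) simp
  have W2: "1 + p x \<bullet> p x = W x ^ 2" by (simp add: W add_nonneg_nonneg)
  have "p x \<bullet> (P *v p x) = (\<Sum>i\<in>UNIV. (p x \<bullet> (P *v axis i 1)) * p x $ i)"
    by (subst matrix_mult_sum) (simp add: inner_sum_right matrix_vector_mult_basis
      scalar_mult_eq_scaleR mult.commute)
  then show "(\<Sum>i\<in>UNIV. ((1 / W x) *\<^sub>R (P *v axis i 1) - ((p x \<bullet> (P *v axis i 1)) / (W x)^3) *\<^sub>R p x) $ i)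
      = (trace P - (p x \<bullet> (P *v p x)) / (1 + p x \<bullet> p x)) / W x"
    unfolding W2
    by (simp add: sum_subtractf trace_def sum_divide_distrib diff_divide_distrib
      matrix_vector_mult_basis column_def power2_eq_square power3_eq_cube)
qed

text \<open>All data are components of the first and second derivatives of \<open>u\<close> on
  space-time, taken within \<open>S\<close>.\<close>

lemma graph_flow_exists:
  fixes u :: "real^'n \<Rightarrow> real \<Rightarrow> real"
  assumes flow: "graph_flows_by_mean_curvature \<Omega> {0..T} u" and \<Omega>: "open \<Omega>" and T: "0 < T"
  shows "\<exists>p q P s. graph_flow \<Omega> T u p q P s"
proof -
  define S where "S = \<Omega> \<times> {0..T}"
  define F where "F = (\<lambda>(x, t). u x t)"
  define D where "D v z = frechet_derivative F (at z within S) v" for v z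
  define E where "E v w z = frechet_derivative (D v) (at z within S) w" for v w z
  have C2: "Ck_on (Suc (Suc 0)) F S"
    using flow by (simp add: graph_flows_by_mean_curvature_def smooth_on_def S_def F_def)
  have F_diff: "F differentiable_on S" and C1: "Ck_on (Suc 0) (D v) S" for v
    using C2[unfolded Ck_on.simps(2)[of "Suc 0"]] unfolding D_def[abs_def] by blast+
  have F: "(F has_derivative (\<lambda>v. D v z)) (at z within S)" if "z \<in> S" for z
    using F_diff that unfolding D_def by (simp add: differentiable_on_def frechet_derivative_works)
  have D_diff: "D v differentiable_on S" for v
    using C1[of v] by (simp only: Ck_on.simps)
  have D: "(D v has_derivative (\<lambda>w. E v w z)) (at z within S)" if "z \<in> S" for v z
    using D_diff that unfolding E_def by (simp add: differentiable_on_def frechet_derivative_works)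
  have E_cont: "continuous_on S (E v w)" for v w
    using C1[of v] unfolding E_def[abs_def] by (simp only: Ck_on.simps)
  have D_cont: "continuous_on S (D v)" for v
    using D_diff by (rule differentiable_imp_continuous_on)
  have F_cont: "continuous_on S F"
    using F_diff by (rule differentiable_imp_continuous_on)
  \<comment> \<open>At interior times \<open>at z within S\<close> is \<open>at z\<close>, so
    derivatives within \<open>S\<close> yield the two-sided directional derivatives required for the
    symmetry.\<close>
  have line: "((\<lambda>r. g (z + r *\<^sub>R v)) has_real_derivative g' v) (at 0)"
    if g: "(g has_derivative g') (at z within S)" and z: "z \<in> \<Omega> \<times> {0<..<T}"
    for g :: "(real^'n) \<times> real \<Rightarrow> real" and g' z v
  proof -
    have "open (\<Omega> \<times> {0<..<T})" using \<Omega> by (simp add: open_Times)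
    moreover have "\<Omega> \<times> {0<..<T} \<subseteq> S" by (auto simp: S_def)
    ultimately have "at z within S = at z"
      using z by (metis at_within_open at_within_open_subset)
    then have "(g has_derivative g') (at (z + 0 *\<^sub>R v))" using g by simp
    then have "((\<lambda>r. g (z + r *\<^sub>R v)) has_derivative (\<lambda>r. g' (r *\<^sub>R v))) (at 0)"
      by (rule has_derivative_compose[rotated]) (auto intro!: derivative_eq_intros)
    moreover have "(\<lambda>r. g' (r *\<^sub>R v)) = (*) (g' v)"
      using linear_scale[OF has_derivative_linear[OF g]] by (simp add: fun_eq_iff mult.commute)
    ultimately show ?thesis by (simp only: has_field_derivative_def)
  qed
  have sym: "E v w z = E w v z" if z: "z \<in> \<Omega> \<times> {0<..<T}" for v w z
  proof -
    have opn: "open (\<Omega> \<times> {0<..<T})" using \<Omega> by (simp add: open_Times)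
    have sub: "\<Omega> \<times> {0<..<T} \<subseteq> S" by (auto simp: S_def)
    have 1: "((\<lambda>r. F (y + r *\<^sub>R v)) has_real_derivative D v y) (at 0)"
      if "y \<in> \<Omega> \<times> {0<..<T}" for y v
      using line[OF F that] sub that by blast
    have 2: "((\<lambda>r. D v (y + r *\<^sub>R w)) has_real_derivative E v w y) (at 0)"
      if "y \<in> \<Omega> \<times> {0<..<T}" for y v w
      using line[OF D that] sub that by blast
    have 3: "continuous_on (\<Omega> \<times> {0<..<T}) (E v w)" for v w
      using E_cont sub continuous_on_subset by blast
    show ?thesis
      by (rule mixed_derivatives_commute[OF opn z 1 1 2 2 3 3])
  qed
  define e where "e i = (axis i 1 :: real^'n, 0::real)" for i
  define p where "p x t = (\<chi> i. D (e i) (x, t))" for x t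
  define q where "q x t = D (0, 1) (x, t)" for x t
  define P where "P x t = (\<chi> i j. E (e i) (e j) (x, t))" for x t
  define s where "s x t = (\<chi> i. E (e i) (0, 1) (x, t))" for x t
  have expand: "g' (h, 0) = (\<chi> i. g' (e i)) \<bullet> h"
    if "(g has_derivative g') (at z within S)" for g g' z and h :: "real^'n"
  proof -
    have "linear g'" using that by (rule has_derivative_linear)
    then have "linear (\<lambda>h. g' (h, 0))"
      by (intro linear_compose[of "\<lambda>h. (h, 0)" g', unfolded o_def]) (auto simp: linear_iff)
    from linear_real_vec_expansion[OF this, of h] show ?thesis by (simp add: e_def)
  qed
  have u_x: "((\<lambda>y. u y t) has_derivative (\<lambda>h. p x t \<bullet> h)) (at x)" if "x \<in> \<Omega>" "t \<in> {0..T}" for x t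
    using has_derivative_slice_space[OF F[of "(x, t)", unfolded S_def] \<Omega> that] that
      expand[OF F[of "(x, t)"]]
    by (simp add: F_def p_def S_def)
  have u_t: "((\<lambda>\<tau>. u x \<tau>) has_real_derivative q x t) (at t within {0..T})"
    if "x \<in> \<Omega>" "t \<in> {0..T}" for x t
    using has_derivative_slice_time[OF F[of "(x, t)", unfolded S_def] that] that
    by (simp add: F_def q_def S_def has_real_derivative_iff_has_vector_derivative)
  have p_x: "((\<lambda>y. p y t) has_derivative (\<lambda>h. P x t *v h)) (at x)" if "x \<in> \<Omega>" "t \<in> {0..T}" for x t
  proof -
    have "((\<lambda>y. D (e i) (y, t)) has_derivative (\<lambda>h. (P x t *v h) $ i)) (at x)" for i
      using has_derivative_slice_space[OF D[of "(x, t)", unfolded S_def] \<Omega> that, of "e i"] that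
        expand[OF D[of "(x, t)" "e i"]]
      by (simp add: P_def S_def inner_vec_def matrix_vector_mult_def mult.commute)
    then show ?thesis
      by (intro has_derivative_vec_componentwise) (simp add: p_def)
  qed
  have p_t: "((\<lambda>\<tau>. p x \<tau>) has_vector_derivative s x t) (at t within {0..T})"
    if "x \<in> \<Omega>" "t \<in> {0..T}" for x t
  proof -
    have "((\<lambda>\<tau>. D (e i) (x, \<tau>)) has_vector_derivative s x t $ i) (at t within {0..T})" for i
      using has_derivative_slice_time[OF D[of "(x, t)", unfolded S_def] that, of "e i"] that
      by (simp add: s_def S_def)
    then show ?thesis
      unfolding has_vector_derivative_def
      by (intro has_derivative_vec_componentwise) (simp add: p_def)
  qed
  have q_x: "((\<lambda>y. q y t) has_derivative (\<lambda>h. s x t \<bullet> h)) (at x)" if "x \<in> \<Omega>" "t \<in> {0<..<T}" for x t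
  proof -
    have "((\<lambda>y. D (0, 1) (y, t)) has_derivative (\<lambda>h. (\<chi> i. E (0, 1) (e i) (x, t)) \<bullet> h)) (at x)"
      using has_derivative_slice_space[OF D[of "(x, t)", unfolded S_def] \<Omega>, of "(0, 1)"] that
        expand[OF D[of "(x, t)" "(0, 1)"]]
      by (simp add: S_def)
    \<comment> \<open>\<open>s\<close> was defined by differentiating \<open>du\<close> in time;
      symmetry identifies it with the spatial gradient of \<open>u_t\<close>.\<close>
    then show ?thesis
      using sym[of "(x, t)" "(0, 1)"] that by (simp add: q_def s_def)
  qed
  have P_sym: "transpose (P x t) = P x t" if "x \<in> \<Omega>" "t \<in> {0<..<T}" for x t
    using sym[of "(x, t)"] that by (simp add: transpose_def P_def vec_eq_iff)
  have ev: "q x t = trace (P x t) - (p x t \<bullet> (P x t *v p x t)) / (1 + p x t \<bullet> p x t)"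
    if xt: "x \<in> \<Omega>" "t \<in> {0..T}" for x t
  proof -
    let ?W = "\<lambda>y. sqrt (1 + p y t \<bullet> p y t)"
    have W: "?W x > 0" by (simp add: add_pos_nonneg)
    have "((\<lambda>y. (1 / area_element (\<lambda>z. u z t) y) *\<^sub>R gradient (\<lambda>z. u z t) y) has_derivative
      (\<lambda>h. (1 / ?W x) *\<^sub>R (P x t *v h) - ((p x t \<bullet> (P x t *v h)) / (?W x)^3) *\<^sub>R p x t)) (at x)"
      by (rule has_derivative_transform_within_open[OF divergence_unit_normal(1)[OF p_x[OF xt] refl] \<Omega> xt(1)])
        (use xt in \<open>simp_all add: area_element_eqI[OF u_x] gradient_eqI[OF u_x]\<close>)
    from frechet_derivative_at[OF this, symmetric]
    have "divergence (\<lambda>y. (1 / area_element (\<lambda>z. u z t) y) *\<^sub>R gradient (\<lambda>z. u z t) y) x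
      = (trace (P x t) - (p x t \<bullet> (P x t *v p x t)) / (1 + p x t \<bullet> p x t)) / ?W x"
      unfolding divergence_def using divergence_unit_normal(2)[OF p_x[OF xt] refl] by simp
    moreover have "((\<lambda>s. u x s) has_real_derivative area_element (\<lambda>y. u y t) x *
           divergence (\<lambda>y. (1 / area_element (\<lambda>z. u z t) y) *\<^sub>R gradient (\<lambda>z. u z t) y) x)
          (at t within {0..T})"
      using flow xt by (simp add: graph_flows_by_mean_curvature_def)
    ultimately have "((\<lambda>s. u x s) has_real_derivative
        (trace (P x t) - (p x t \<bullet> (P x t *v p x t)) / (1 + p x t \<bullet> p x t))) (at t within {0..T})"
      using W area_element_eqI[OF u_x[OF xt]] by simp
    \<comment> \<open>A nontrivial filter makes the time derivative unique, so \<open>q\<close>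
      equals the prescribed speed.\<close>
    moreover have "at t within {0..T} \<noteq> bot"
      using xt T by (simp add: trivial_limit_within islimpt_Icc)
    ultimately show ?thesis
      using has_field_derivative_unique u_t[OF xt] by blast
  qed
  have "graph_flow \<Omega> T u p q P s"
  proof
    show "continuous_on (\<Omega> \<times> {0..T}) (\<lambda>(x, t). u x t)"
      using F_cont by (simp add: F_def S_def)
    show "continuous_on (\<Omega> \<times> {0..T}) (\<lambda>(x, t). p x t)"
      "continuous_on (\<Omega> \<times> {0..T}) (\<lambda>(x, t). q x t)"
      "continuous_on (\<Omega> \<times> {0..T}) (\<lambda>(x, t). P x t)"
      "continuous_on (\<Omega> \<times> {0..T}) (\<lambda>(x, t). s x t)"
      unfolding p_def q_def P_def s_def split_beta S_def[symmetric] prod.collapse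
      by (intro continuous_on_vec_lambda D_cont E_cont)+
  qed (fact \<Omega> T u_x u_t p_x p_t q_x P_sym ev)+
  then show ?thesis by blast
qed

subsection \<open>Height bound\<close>

context graph_flow
begin

text \<open>The spheres of squared radius \<open>\<rho>\<^sup>2 - 2 n t\<close> about
  \<open>(0, c)\<close> move by mean curvature, and a graph that starts outside stays outside. The
  minimum principle is applied to \<open>f\<close>, perturbed by \<open>e t\<close> to make the
  inequality strict.\<close>

lemma sphere_barrier:
  assumes \<rho>: "cball 0 \<rho> \<subseteq> \<Omega>" "0 < \<rho>"
    and init: "\<And>x. x \<in> cball 0 \<rho> \<Longrightarrow> \<rho> \<le> \<bar>u x 0 - c\<bar>"
    and xt: "x0 \<in> cball 0 \<rho>" "t0 \<in> {0..T}"
  shows "\<rho>\<^sup>2 \<le> x0 \<bullet> x0 + (u x0 t0 - c)\<^sup>2 + 2 * real CARD('n) * t0"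
proof (rule ccontr)
  define f where "f x t = x \<bullet> x + (u x t - c)\<^sup>2 + 2 * real CARD('n) * t" for x t
  assume "\<not> ?thesis"
  then have lt: "f x0 t0 < \<rho>\<^sup>2" by (simp add: f_def)
  \<comment> \<open>With this \<open>e\<close> the perturbation is at most half the gap
    \<open>\<rho>\<^sup>2 - f x0 t0\<close>, so the perturbed minimum still lies below
    \<open>\<rho>\<^sup>2\<close>.\<close>
  define e where "e = (\<rho>\<^sup>2 - f x0 t0) / (2 * T)"
  have e: "e > 0" using lt T_pos by (simp add: e_def)
  have small: "f x0 t0 + e * t0 < \<rho>\<^sup>2"
  proof -
    have "e * t0 \<le> e * T" using xt e by (intro mult_left_mono) auto
    also have "\<dots> = (\<rho>\<^sup>2 - f x0 t0) / 2" using T_pos by (simp add: e_def)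
    finally show ?thesis using lt by (simp add: field_simps)
  qed
  have u_cont': "continuous_on (cball 0 \<rho> \<times> {0..T}) (\<lambda>z. u (fst z) (snd z))"
    using continuous_on_subset[OF u_cont, of "cball 0 \<rho> \<times> {0..T}"] \<rho>
    by (auto simp: split_beta)
  have "continuous_on (cball 0 \<rho> \<times> {0..T}) (\<lambda>z. f (fst z) (snd z) + e * snd z)"
    unfolding f_def by (intro continuous_intros u_cont')
  moreover have "compact (cball (0::real^'n) \<rho> \<times> {0..T})" by (intro compact_Times) auto
  moreover have "cball (0::real^'n) \<rho> \<times> {0..T} \<noteq> {}" using xt \<rho>(2) by auto
  ultimately obtain z where z: "z \<in> cball 0 \<rho> \<times> {0..T}"
    and z_min: "\<And>w. w \<in> cball 0 \<rho> \<times> {0..T} \<Longrightarrow>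
      f (fst z) (snd z) + e * snd z \<le> f (fst w) (snd w) + e * snd w"
    using continuous_attains_inf[of "cball 0 \<rho> \<times> {0..T}" "\<lambda>z. f (fst z) (snd z) + e * snd z"] by blast
  define y \<tau> where "y = fst z" and "\<tau> = snd z"
  have y: "y \<in> cball 0 \<rho>" "\<tau> \<in> {0..T}" using z by (auto simp: y_def \<tau>_def)
  have min: "f y \<tau> + e * \<tau> \<le> f x t + e * t" if "x \<in> cball 0 \<rho>" "t \<in> {0..T}" for x t
    using z_min[of "(x, t)"] that by (simp add: y_def \<tau>_def)
  have val: "f y \<tau> + e * \<tau> < \<rho>\<^sup>2" using min[OF xt] small by linarith
  \<comment> \<open>The minimum avoids the parabolic boundary: at time 0 and on the sphere
    \<open>norm x = \<rho>\<close> the function is at least \<open>\<rho>\<^sup>2\<close>.\<close>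
  have "\<tau> \<noteq> 0"
  proof
    assume "\<tau> = 0"
    then have "(u y 0 - c)\<^sup>2 < \<rho>\<^sup>2" using val by (simp add: f_def) (smt (verit) inner_ge_zero)
    moreover have "\<rho>\<^sup>2 \<le> (u y 0 - c)\<^sup>2"
      using power_mono[OF init[OF y(1)], of 2] \<rho> by simp
    ultimately show False by simp
  qed
  then have \<tau>: "0 < \<tau>" using y by simp
  have "y \<bullet> y \<le> f y \<tau> + e * \<tau>" using \<tau> e by (simp add: f_def)
  then have "(norm y)\<^sup>2 < \<rho>\<^sup>2" using val by (simp add: power2_norm_eq_inner)
  then have norm_y: "norm y < \<rho>" using \<rho> by (simp add: power2_less_imp_less)
  have y\<Omega>: "y \<in> \<Omega>" using y \<rho> by auto
  define a where "a = u y \<tau> - c"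
  let ?p = "p y \<tau>" and ?P = "P y \<tau>"
  \<comment> \<open>Comparison with earlier times only, since \<tau> may be the final time.\<close>
  have "2 * a * q y \<tau> + 2 * real CARD('n) + e \<le> 0"
  proof (rule ccontr)
    assume pos: "\<not> ?thesis"
    have "((\<lambda>t. f y t + e * t) has_real_derivative 2 * a * q y \<tau> + 2 * real CARD('n) + e)
        (at \<tau> within {0..T})"
      unfolding f_def a_def using u_t[OF y\<Omega> y(2)]
      by (auto intro!: derivative_eq_intros)
    from has_real_derivative_pos_inc_left[OF this] obtain d where d: "d > 0"
      "\<And>h. h > 0 \<Longrightarrow> \<tau> - h \<in> {0..T} \<Longrightarrow> h < d \<Longrightarrow> f y (\<tau> - h) + e * (\<tau> - h) < f y \<tau> + e * \<tau>"
      using pos by auto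
    define h where "h = min d \<tau> / 2"
    have "h > 0" "h < d" "\<tau> - h \<in> {0..T}" using d \<tau> y by (auto simp: h_def min_def)
    then show False using d(2)[of h] min[OF y(1), of "\<tau> - h"] by auto
  qed
  moreover have "0 \<le> 2 * a * q y \<tau> + 2 * real CARD('n)"
  proof -
    \<comment> \<open>\<open>H\<close> is the spatial Hessian of \<open>f\<close> at the minimum. In
      its contraction with \<open>I - p p^T / W^2\<close> the part \<open>2 I + 2 p p^T\<close>
      contributes exactly \<open>2 n\<close>, and the part \<open>2 a P\<close> contributes
      \<open>2 a q\<close>.\<close>
    define H :: "real^'n^'n" where
      "H = 2 *\<^sub>R mat 1 + (\<chi> i j. 2 * ?p $ i * ?p $ j) + (2 * a) *\<^sub>R ?P"
    have "(\<chi> i j. 2 * ?p $ i * ?p $ j) *v v = (2 * (?p \<bullet> v)) *\<^sub>R ?p" for v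
      by (simp add: matrix_vector_mult_def inner_vec_def vec_eq_iff sum_distrib_left mult_ac)
    then have H: "H *v v = 2 *\<^sub>R v + (2 * (?p \<bullet> v)) *\<^sub>R ?p + (2 * a) *\<^sub>R (?P *v v)" for v
      unfolding H_def matrix_vector_mult_add_rdistrib scaleR_matrix_vector_assoc[symmetric] by simp
    have "0 \<le> v \<bullet> (H *v v)" for v
    proof -
      obtain d where d: "d > 0" "\<And>r. \<bar>r\<bar> < d \<Longrightarrow> y + r *\<^sub>R v \<in> cball 0 \<rho>"
      proof
        show "(\<rho> - norm y) / (norm v + 1) > 0" using norm_y by (simp add: add_nonneg_pos)
        fix r :: real assume "\<bar>r\<bar> < (\<rho> - norm y) / (norm v + 1)"
        then have "\<bar>r\<bar> * (norm v + 1) < \<rho> - norm y"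
          by (simp add: pos_less_divide_eq add_nonneg_pos)
        then have "\<bar>r\<bar> * norm v \<le> \<rho> - norm y" by (simp add: algebra_simps)
        then show "y + r *\<^sub>R v \<in> cball 0 \<rho>"
          using norm_triangle_ineq[of y "r *\<^sub>R v"] by simp
      qed
      have line: "((\<lambda>r. y + r *\<^sub>R v) has_derivative (\<lambda>h. h *\<^sub>R v)) (at r)" for r
        by (auto intro!: derivative_eq_intros)
      define g' where "g' r = 2 * ((y + r *\<^sub>R v) \<bullet> v)
        + 2 * (u (y + r *\<^sub>R v) \<tau> - c) * (p (y + r *\<^sub>R v) \<tau> \<bullet> v)" for r
      have u_line: "((\<lambda>r. u (y + r *\<^sub>R v) \<tau>) has_real_derivative p (y + r *\<^sub>R v) \<tau> \<bullet> v) (at r)"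
        if "\<bar>r\<bar> < d" for r
        using has_derivative_compose[OF line u_x[of "y + r *\<^sub>R v" \<tau>]] d(2)[OF that] \<rho> y(2)
        by (auto simp: has_field_derivative_def mult.commute subset_eq elim!: has_derivative_eq_rhs)
      have p_line: "((\<lambda>r. p (y + r *\<^sub>R v) \<tau> \<bullet> v) has_real_derivative v \<bullet> (?P *v v)) (at 0)"
      proof -
        have "((\<lambda>r. p (y + r *\<^sub>R v) \<tau>) has_derivative (\<lambda>h. ?P *v (h *\<^sub>R v))) (at 0)"
          using has_derivative_compose[OF line[of 0], of "\<lambda>x. p x \<tau>"] p_x[OF y\<Omega> y(2)] by simp
        from has_derivative_inner_left[OF this, of v] show ?thesis
          unfolding has_field_derivative_def
          by (rule has_derivative_eq_rhs) (simp add: fun_eq_iff matrix_vector_mult_scaleR inner_commute)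
      qed
      have "0 \<le> 2 * (v \<bullet> v) + 2 * (?p \<bullet> v) * (?p \<bullet> v) + 2 * a * (v \<bullet> (?P *v v))"
      proof (rule local_min_second_derivative_nonneg[OF d(1)])
        show "((\<lambda>r. f (y + r *\<^sub>R v) \<tau>) has_real_derivative g' r) (at r)" if "\<bar>r\<bar> < d" for r
          unfolding f_def g'_def inner_add_left inner_add_right inner_scaleR_left inner_scaleR_right
          using u_line[OF that]
          by (auto intro!: derivative_eq_intros simp: inner_commute algebra_simps)
        show "(g' has_real_derivative 2 * (v \<bullet> v) + 2 * (?p \<bullet> v) * (?p \<bullet> v) + 2 * a * (v \<bullet> (?P *v v))) (at 0)"
          unfolding g'_def[abs_def] a_def inner_add_left inner_scaleR_left
          using u_line[of 0] p_line d(1)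
          by (auto intro!: derivative_eq_intros simp: algebra_simps)
        show "f (y + 0 *\<^sub>R v) \<tau> \<le> f (y + r *\<^sub>R v) \<tau>" if "\<bar>r\<bar> < d" for r
          using min[OF d(2)[OF that] y(2)] by simp
      qed
      then show ?thesis
        by (simp add: H inner_add_right inner_commute)
    qed
    from graph_trace_nonneg[of H ?p, OF this]
    have "0 \<le> trace H - (?p \<bullet> (H *v ?p)) / (1 + ?p \<bullet> ?p)" .
    also have "trace H = 2 * real CARD('n) + 2 * (?p \<bullet> ?p) + 2 * a * trace ?P"
      by (simp add: H_def trace_def mat_def inner_vec_def sum.distrib sum_distrib_left mult.assoc)
    also have "?p \<bullet> (H *v ?p) = 2 * (?p \<bullet> ?p) * (1 + ?p \<bullet> ?p) + 2 * a * (?p \<bullet> (?P *v ?p))"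
      by (simp add: H inner_add_right algebra_simps)
    also have "2 * real CARD('n) + 2 * (?p \<bullet> ?p) + 2 * a * trace ?P -
        (2 * (?p \<bullet> ?p) * (1 + ?p \<bullet> ?p) + 2 * a * (?p \<bullet> (?P *v ?p))) / (1 + ?p \<bullet> ?p)
        = 2 * a * q y \<tau> + 2 * real CARD('n)"
    proof -
      have "1 + ?p \<bullet> ?p \<noteq> 0" by (smt (verit) inner_ge_zero)
      then show ?thesis
        unfolding evolution[OF y\<Omega> y(2)] by (simp add: add_divide_distrib right_diff_distrib)
    qed
    finally show ?thesis .
  qed
  ultimately show False using e by linarith
qed

text \<open>The same point \<open>x\<close> stays inside the shrinking sphere at all earlier times, so along
  \<open>\<tau> \<mapsto> u x \<tau>\<close> the values \<open>\<plusminus>(M + R)\<close> are never attained.\<close>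

lemma height_bound:
  assumes \<Omega>: "\<Omega> = ball 0 R" and init: "\<And>x. x \<in> \<Omega> \<Longrightarrow> \<bar>u x 0\<bar> \<le> M"
    and t: "t \<in> {0..T}" and xt: "x \<bullet> x + 2 * real CARD('n) * t < R\<^sup>2" and R: "0 < R"
  shows "\<bar>u x t\<bar> \<le> M + R"
proof -
  define b where "b = x \<bullet> x + 2 * real CARD('n) * t"
  have b: "0 \<le> b" "b < R\<^sup>2" using t xt by (auto simp: b_def)
  \<comment> \<open>\<open>\<rho>\<^sup>2\<close> is the midpoint of \<open>b\<close> and
    \<open>R\<^sup>2\<close>: below \<open>R\<^sup>2\<close>, so that the closed ball fits into
    \<Omega>, and above \<open>b\<close>, so that the barrier is violated if \<open>u\<close>
    attains \<open>c\<close>.\<close>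
  define \<rho> where "\<rho> = sqrt ((b + R\<^sup>2) / 2)"
  have \<rho>2: "\<rho>\<^sup>2 = (b + R\<^sup>2) / 2" using b by (simp add: \<rho>_def)
  have \<rho>: "0 < \<rho>" "\<rho> < R"
    using b R by (auto simp: \<rho>_def intro: real_less_lsqrt)
  have sub: "cball 0 \<rho> \<subseteq> \<Omega>" using \<rho> \<Omega> by auto
  have "x \<bullet> x \<le> b" using t by (simp add: b_def)
  then have "(norm x)\<^sup>2 \<le> \<rho>\<^sup>2" using b by (simp add: \<rho>2 power2_norm_eq_inner)
  then have x: "x \<in> cball 0 \<rho>" using \<rho> power2_le_imp_le[of "norm x" \<rho>] by simp
  then have x\<Omega>: "x \<in> \<Omega>" using sub by blast
  have avoid: "u x \<tau> \<noteq> c" if c: "\<bar>c\<bar> = M + R" and \<tau>: "\<tau> \<in> {0..t}" for c \<tau>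
  proof
    assume "u x \<tau> = c"
    have "\<rho> \<le> \<bar>u y 0 - c\<bar>" if "y \<in> cball 0 \<rho>" for y
      using init[of y] sub that c \<rho> by fastforce
    from sphere_barrier[OF sub \<rho>(1) this x, of \<tau>]
    have "\<rho>\<^sup>2 \<le> x \<bullet> x + 2 * real CARD('n) * \<tau>"
      using \<tau> t \<open>u x \<tau> = c\<close> by simp
    also have "\<dots> \<le> b" using \<tau> unfolding b_def by (intro add_left_mono mult_left_mono) auto
    finally show False using \<rho>2 b by simp
  qed
  have cont: "continuous_on {0..t} (\<lambda>\<tau>. u x \<tau>)"
    using continuous_on_subset[OF DERIV_continuous_on[of "{0..T}", OF u_t[OF x\<Omega>]]] t by auto
  have u0: "\<bar>u x 0\<bar> \<le> M" by (rule init[OF x\<Omega>])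
  have "u x t < M + R"
  proof (rule ccontr)
    assume "\<not> ?thesis"
    then have "\<exists>\<tau>. 0 \<le> \<tau> \<and> \<tau> \<le> t \<and> u x \<tau> = M + R"
      using u0 R t cont by (intro IVT') auto
    then show False using avoid[of "M + R"] u0 R by auto
  qed
  moreover have "- (M + R) < u x t"
  proof (rule ccontr)
    assume "\<not> ?thesis"
    then have "\<exists>\<tau>. 0 \<le> \<tau> \<and> \<tau> \<le> t \<and> u x \<tau> = - (M + R)"
      using u0 R t cont by (intro IVT2') auto
    then show False using avoid[of "- (M + R)"] u0 R by auto
  qed
  ultimately show ?thesis by linarith
qed

end

subsection \<open>Localized area\<close>

text \<open>The relatively open sets \<open>\<Omega> \<times> I\<close> and
  \<open>(- K) \<times> I\<close> cover everything, and on their overlap both formulas give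
  0.\<close>

lemma zero_extension_continuous:
  fixes g :: "'a::topological_space \<Rightarrow> 'b::topological_space \<Rightarrow> 'c::real_normed_vector"
  assumes "open \<Omega>" "closed K" "K \<subseteq> \<Omega>" and g: "continuous_on (\<Omega> \<times> I) (\<lambda>(x, t). g x t)"
    and 0: "\<And>x t. x \<in> \<Omega> \<Longrightarrow> x \<notin> K \<Longrightarrow> t \<in> I \<Longrightarrow> g x t = 0"
  shows "continuous_on (UNIV \<times> I) (\<lambda>(x, t). if x \<in> \<Omega> then g x t else 0)" (is "continuous_on _ ?h")
proof -
  have cover: "UNIV \<times> I = \<Omega> \<times> I \<union> (- K) \<times> I" using assms(3) by auto
  have rel: "openin (top_of_set (UNIV \<times> I)) (U \<times> I)" if "open U" for U :: "'a set"
    using that by (auto simp: openin_open intro!: exI[of _ "U \<times> UNIV"] open_Times)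
  show ?thesis
    unfolding cover
  proof (rule continuous_on_Un_local_open; (fold cover)?)
    show "openin (top_of_set (UNIV \<times> I)) (\<Omega> \<times> I)" "openin (top_of_set (UNIV \<times> I)) ((- K) \<times> I)"
      using assms(1,2) by (intro rel; auto)+
    show "continuous_on (\<Omega> \<times> I) ?h"
      by (rule continuous_on_eq[OF g]) auto
    show "continuous_on ((- K) \<times> I) ?h"
      by (rule continuous_on_eq[OF continuous_on_const[of _ 0]]) (auto simp: 0)
  qed
qed

lemma continuous_on_slice:
  assumes "continuous_on (A \<times> I) (\<lambda>(x, t). g x t)" "t \<in> I"
  shows "continuous_on A (\<lambda>x. g x t)"
proof -
  have "continuous_on A (\<lambda>x. (x, t))" by (intro continuous_intros)
  moreover have "(\<lambda>x. (x, t)) ` A \<subseteq> A \<times> I" using assms(2) by auto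
  ultimately show ?thesis
    using continuous_on_compose2[OF assms(1)] by fastforce
qed

text \<open>Only \<open>y = 0\<close> is delicate. There an exponent of at least 2 leaves
  \<open>(max 0 z) ^ Suc k\<close> as a continuous difference quotient that vanishes at 0, as in
  Caratheodory's criterion.\<close>

lemma max_power_has_real_derivative:
  "((\<lambda>y::real. (max 0 y) ^ Suc (Suc k)) has_real_derivative real (Suc (Suc k)) * (max 0 y) ^ Suc k) (at y)"
proof -
  consider "y < 0" | "y = 0" | "y > 0" by linarith
  then show ?thesis
  proof cases
    case 1
    have "((\<lambda>y::real. 0) has_real_derivative real (Suc (Suc k)) * (max 0 y) ^ Suc k) (at y)"
      using 1 by simp
    then show ?thesis
      by (rule has_field_derivative_transform_within_open[of _ _ _ "{..<0}"]) (use 1 in auto)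
  next
    case 2
    have "\<exists>g. (\<forall>z. (max 0 z) ^ Suc (Suc k) - (max 0 (0::real)) ^ Suc (Suc k) = g z * (z - 0))
        \<and> isCont g 0 \<and> g 0 = 0"
    proof (intro exI[of _ "\<lambda>z. (max 0 z) ^ Suc k"] conjI allI)
      show "isCont (\<lambda>z::real. (max 0 z) ^ Suc k) 0" by (intro continuous_intros)
    qed (auto simp: max_def)
    then show ?thesis
      unfolding 2 CARAT_DERIV by simp
  next
    case 3
    have "((\<lambda>y::real. y ^ Suc (Suc k)) has_real_derivative real (Suc (Suc k)) * (max 0 y) ^ Suc k) (at y)"
      using DERIV_pow[of "Suc (Suc k)" y UNIV] 3 by simp
    then show ?thesis
      by (rule has_field_derivative_transform_within_open[of _ _ _ "{0<..}"]) (use 3 in auto)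
  qed
qed

lemma max_square_has_real_derivative:
  "((\<lambda>y::real. (max 0 y)\<^sup>2) has_real_derivative 2 * max 0 y) (at y)"
  using max_power_has_real_derivative[of 0 y] by (simp add: numeral_2_eq_2)

lemma max_cube_has_real_derivative:
  "((\<lambda>y::real. (max 0 y)^3) has_real_derivative 3 * (max 0 y)\<^sup>2) (at y)"
  using max_power_has_real_derivative[of 1 y] by (simp add: numeral_3_eq_3 numeral_2_eq_2)

lemma linear_sum_components:
  fixes f :: "real^'n \<Rightarrow> real"
  assumes "linear f"
  shows "(\<Sum>i\<in>UNIV. f (axis i 1) * v $ i) = f v"
  using linear_real_vec_expansion[OF assms, of v] by (simp add: inner_vec_def)

text \<open>The left-hand side is \<open>\<partial>\<^sub>t (t\<^sup>2 z\<^sup>3 W)\<close> minus the divergence of the vector field \<open>z\<^sup>2 flux\<close>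
  below, with \<open>Q = u\<^sub>t\<close>, \<open>U = u\<close>, \<open>d = \<langle>du\<^sub>t, du\<rangle>\<close>, \<open>xp = \<langle>x, du\<rangle>\<close> and \<open>xPp = \<langle>x, D\<^sup>2u du\<rangle>\<close>.\<close>

lemma localized_area_inequality:
  fixes z W pp xp xPp xx Q U t N \<rho> T d n :: real
  assumes W: "W > 0" "W\<^sup>2 = 1 + pp" and z: "0 < z" "z \<le> \<rho>\<^sup>2" and t: "0 \<le> t" "t \<le> T"
    and U: "\<bar>U\<bar> \<le> N" and \<rho>: "0 < \<rho>" and xx: "0 \<le> xx" "xx \<le> \<rho>\<^sup>2"
    and CS: "xp\<^sup>2 \<le> xx * pp" and pp: "0 \<le> pp"
  shows "2 * t * z^3 * W + t\<^sup>2 * (- 6 * n * z\<^sup>2 * W + z^3 * (d / W))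
     - (z\<^sup>2 * ((t\<^sup>2 * (z * Q + 6 * xp) + 2 * t * U * z) * (Q / W)
          + (t\<^sup>2 * (- 2 * xp * Q + z * d + 6 * pp + 6 * xPp) + 2 * t * (pp * z - 2 * U * xp)) / W
          - 6 * t\<^sup>2 * (n * W + xPp / W))
       - 4 * z * ((t\<^sup>2 * (z * Q + 6 * xp) + 2 * t * U * z) * (xp / W) - 6 * t\<^sup>2 * W * xx))
    \<le> 2 * T * \<rho>^6 + 12 * T * N * \<rho>^5 + N\<^sup>2 * \<rho>^6" (is "?lhs \<le> _")
proof -
  have W1: "1 \<le> W" using W pp by (smt (verit) one_power2 power2_le_imp_le)
  have N: "0 \<le> N" using U by linarith
  have pp': "pp = W\<^sup>2 - 1" using W by simp
  \<comment> \<open>The terms in \<open>d\<close>, \<open>n\<close>, \<open>xPp\<close> and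
    \<open>xp * Q\<close> cancel, \<open>W^2 = 1 + pp\<close> reduces \<open>2 t z^3 W\<close> to
    \<open>2 t z^3 / W\<close>, and the remaining terms in \<open>Q\<close> are completed to the
    square of \<open>t Q + U\<close>.\<close>
  have "?lhs = 2 * t * z^3 / W + 24 * t\<^sup>2 * z * (xp\<^sup>2 - W\<^sup>2 * xx) / W - 6 * t\<^sup>2 * z\<^sup>2 * pp / W
      - z^3 * (t * Q + U)\<^sup>2 / W + z^3 * U\<^sup>2 / W + 12 * t * U * z\<^sup>2 * xp / W"
    unfolding pp' using W(1) by (simp add: field_simps power2_eq_square power3_eq_cube)
  also have "\<dots> \<le> 2 * T * \<rho>^6 + 0 - 0 - 0 + N\<^sup>2 * \<rho>^6 + 12 * T * N * \<rho>^5"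
  proof (intro add_mono diff_mono)
    have z3: "z^3 \<le> \<rho>^6"
      using power_mono[OF z(2), of 3] z by (simp flip: power_mult)
    have "2 * t * z^3 / W \<le> 2 * t * z^3 / 1"
      using W1 t z by (intro divide_left_mono) auto
    also have "\<dots> \<le> 2 * T * \<rho>^6"
      using z3 t z by (simp add: mult_mono)
    finally show "2 * t * z^3 / W \<le> 2 * T * \<rho>^6" .
    have "xx * pp \<le> W\<^sup>2 * xx" using xx by (simp add: W algebra_simps)
    then have "xp\<^sup>2 - W\<^sup>2 * xx \<le> 0" using CS by simp
    then show "24 * t\<^sup>2 * z * (xp\<^sup>2 - W\<^sup>2 * xx) / W \<le> 0"
      using z W by (intro divide_nonpos_pos mult_nonneg_nonpos) auto
    show "0 \<le> 6 * t\<^sup>2 * z\<^sup>2 * pp / W" using pp W by auto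
    show "0 \<le> z^3 * (t * Q + U)\<^sup>2 / W" using z W by auto
    have U2: "U\<^sup>2 \<le> N\<^sup>2" using power_mono[OF U, of 2] by simp
    have "z^3 * U\<^sup>2 / W \<le> z^3 * U\<^sup>2 / 1"
      using W1 z by (intro divide_left_mono) auto
    also have "\<dots> \<le> N\<^sup>2 * \<rho>^6"
      using mult_mono[OF U2 z3] z by (simp add: mult.commute)
    finally show "z^3 * U\<^sup>2 / W \<le> N\<^sup>2 * \<rho>^6" .
    \<comment> \<open>Cauchy-Schwarz and \<open>pp \<le> W^2\<close>: the quotient
      \<open>xp / W\<close> is bounded however steep the graph is.\<close>
    have "xp\<^sup>2 \<le> \<rho>\<^sup>2 * W\<^sup>2"
      using CS mult_mono[of xx "\<rho>\<^sup>2" pp "W\<^sup>2"] xx pp W by simp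
    then have "\<bar>xp\<bar> \<le> \<rho> * W"
      using \<rho> W by (metis abs_le_square_iff abs_of_pos mult_pos_pos power_mult_distrib)
    then have xpW: "\<bar>xp\<bar> / W \<le> \<rho>" using W by (simp add: pos_divide_le_eq)
    have "12 * t * U * z\<^sup>2 * xp / W \<le> 12 * t * \<bar>U\<bar> * z\<^sup>2 * (\<bar>xp\<bar> / W)"
    proof -
      have "U * xp \<le> \<bar>U\<bar> * \<bar>xp\<bar>" by (metis abs_ge_self abs_mult)
      then have "12 * t * z\<^sup>2 / W * (U * xp) \<le> 12 * t * z\<^sup>2 / W * (\<bar>U\<bar> * \<bar>xp\<bar>)"
        using t W by (intro mult_left_mono) auto
      then show ?thesis by (simp add: ac_simps)
    qed
    also have "\<dots> \<le> 12 * T * N * (\<rho>\<^sup>2)\<^sup>2 * \<rho>"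
      using xpW t U z N W by (intro mult_mono power_mono) auto
    also have "\<dots> = 12 * T * N * \<rho>^5" by (simp add: power_numeral_reduce)
    finally show "12 * t * U * z\<^sup>2 * xp / W \<le> 12 * T * N * \<rho>^5" .
  qed
  finally show ?thesis by simp
qed

text \<open>Bridge from the gauge integral over a box, in which the estimates are made, to the
  Lebesgue integral of the claim.\<close>

lemma set_nn_integral_le_integral:
  fixes h :: "'a::euclidean_space \<Rightarrow> real"
  assumes h: "continuous_on UNIV h" "\<And>x. 0 \<le> h x" and "A \<subseteq> cbox a b"
    and f: "\<And>x. x \<in> A \<Longrightarrow> f x \<le> h x"
  shows "(\<integral>\<^sup>+x\<in>A. ennreal (f x) \<partial>lborel) \<le> ennreal (integral (cbox a b) h)"
proof -
  have "(h has_integral integral (cbox a b) h) (cbox a b)"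
    by (intro integrable_integral integrable_continuous continuous_on_subset[OF h(1)]) auto
  from nn_integral_has_integral_lebesgue[OF h(2) this]
  have "(\<integral>\<^sup>+x. ennreal (indicator (cbox a b) x * h x) \<partial>lborel) = ennreal (integral (cbox a b) h)" .
  moreover have "(\<integral>\<^sup>+x\<in>A. ennreal (f x) \<partial>lborel) \<le> (\<integral>\<^sup>+x. ennreal (indicator (cbox a b) x * h x) \<partial>lborel)"
    using assms(3) by (intro nn_integral_mono) (auto simp: indicator_def intro!: ennreal_leI f)
  ultimately show ?thesis by simp
qed

section \<open>The weighted area and its time derivative\<close>

text \<open>The height bound \<open>N\<close> is required only where the cutoff \<open>zeta\<close>
  is positive; \<open>cball 0 \<rho>\<close> contains the support of the cutoff at all
  times.\<close>

locale localized_graph_flow = graph_flow \<Omega> T u p q P s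
  for \<Omega> :: "(real^'n) set" and T u p q P s +
  fixes \<rho> N :: real
  assumes \<rho>: "0 < \<rho>" and cball_sub: "cball 0 \<rho> \<subseteq> \<Omega>"
    and height: "\<And>x t. x \<in> \<Omega> \<Longrightarrow> t \<in> {0..T} \<Longrightarrow> x \<bullet> x + 2 * real CARD('n) * t < \<rho>\<^sup>2 \<Longrightarrow> \<bar>u x t\<bar> \<le> N"
    and N_nonneg: "0 \<le> N"
begin

definition W :: "real^'n \<Rightarrow> real \<Rightarrow> real" where
  "W x t = sqrt (1 + p x t \<bullet> p x t)"

definition psi :: "real^'n \<Rightarrow> real \<Rightarrow> real" where
  "psi x t = \<rho>\<^sup>2 - x \<bullet> x - 2 * real CARD('n) * t"

definition zeta :: "real^'n \<Rightarrow> real \<Rightarrow> real" where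
  "zeta x t = max 0 (psi x t)"

text \<open>Since \<open>d(zeta^3) = - 6 zeta^2 x\<close>, the product \<open>zeta^2 coef\<close>
  equals \<open>t^2 (zeta^3 u_t - <d(zeta^3), du>) + 2 t u zeta^3\<close>. Primed names below denote
  the spatial derivatives in direction \<open>h\<close>.\<close>

definition coef :: "real^'n \<Rightarrow> real \<Rightarrow> real" where
  "coef x t = t\<^sup>2 * (psi x t * q x t + 6 * (x \<bullet> p x t)) + 2 * t * u x t * psi x t"

definition coef' :: "real^'n \<Rightarrow> real \<Rightarrow> real^'n \<Rightarrow> real" where
  "coef' x t h = t\<^sup>2 * (- 2 * (x \<bullet> h) * q x t + psi x t * (s x t \<bullet> h) + 6 * (h \<bullet> p x t) + 6 * (x \<bullet> (P x t *v h)))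
    + 2 * t * ((p x t \<bullet> h) * psi x t - 2 * u x t * (x \<bullet> h))"

text \<open>The field \<open>\<zeta>\<^sup>2 flux\<close> collects the total divergences that arise when the first variation of area is
  integrated by parts twice and \<open>2 t \<zeta>\<^sup>3 u\<close> is used as a test function; one factor \<open>\<zeta>\<close> stays inside
  as \<open>psi\<close>, which is smooth and equals \<open>\<zeta>\<close> wherever \<open>\<zeta> \<noteq> 0\<close>.\<close>

definition flux :: "real^'n \<Rightarrow> real \<Rightarrow> real^'n" where
  "flux x t = coef x t *\<^sub>R ((1 / W x t) *\<^sub>R p x t) - (6 * t\<^sup>2 * W x t) *\<^sub>R x"

definition flux' :: "real^'n \<Rightarrow> real \<Rightarrow> real^'n \<Rightarrow> real^'n" where
  "flux' x t h = coef x t *\<^sub>R ((1 / W x t) *\<^sub>R (P x t *v h) - ((p x t \<bullet> (P x t *v h)) / (W x t)^3) *\<^sub>R p x t)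
    + coef' x t h *\<^sub>R ((1 / W x t) *\<^sub>R p x t)
    - ((6 * t\<^sup>2 * W x t) *\<^sub>R h + (6 * t\<^sup>2 * ((p x t \<bullet> (P x t *v h)) / W x t)) *\<^sub>R x)"

definition field' :: "real^'n \<Rightarrow> real \<Rightarrow> real^'n \<Rightarrow> real^'n" where
  "field' x t h = (zeta x t)\<^sup>2 *\<^sub>R flux' x t h - (4 * zeta x t * (x \<bullet> h)) *\<^sub>R flux x t"

definition density :: "real^'n \<Rightarrow> real \<Rightarrow> real" where
  "density x t = t\<^sup>2 * (zeta x t)^3 * W x t"

definition density_t :: "real^'n \<Rightarrow> real \<Rightarrow> real" where
  "density_t x t = 2 * t * (zeta x t)^3 * W x t
    + t\<^sup>2 * (- 6 * real CARD('n) * (zeta x t)\<^sup>2 * W x t + (zeta x t)^3 * ((s x t \<bullet> p x t) / W x t))"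

lemma W_pos: "0 < W x t"
  by (simp add: W_def add_pos_nonneg)

lemma W_square: "(W x t)\<^sup>2 = 1 + p x t \<bullet> p x t"
  by (simp add: W_def add_nonneg_nonneg)

lemma zeta_outside: "zeta x t = 0" if "x \<notin> cball 0 \<rho>" "0 \<le> t"
proof -
  have "\<rho>\<^sup>2 \<le> x \<bullet> x"
    using that(1) \<rho> power_mono[of \<rho> "norm x" 2] by (simp add: power2_norm_eq_inner)
  moreover have "0 \<le> 2 * real CARD('n) * t" using that by simp
  ultimately have "psi x t \<le> 0" unfolding psi_def by linarith
  then show ?thesis by (simp add: zeta_def)
qed

lemma psi_x: "((\<lambda>y. psi y t) has_derivative (\<lambda>h. - 2 * (x \<bullet> h))) (at x)"
  unfolding psi_def by (auto intro!: derivative_eq_intros simp: inner_commute)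

lemma zeta_square_x: "((\<lambda>y. (zeta y t)\<^sup>2) has_derivative (\<lambda>h. - (4 * zeta x t * (x \<bullet> h)))) (at x)"
  unfolding zeta_def
  by (rule has_derivative_eq_rhs[OF DERIV_compose_FDERIV[OF max_square_has_real_derivative psi_x]])
    (simp add: fun_eq_iff)

lemma zeta_cube_t: "((\<lambda>t. (zeta x t)^3) has_real_derivative - 6 * real CARD('n) * (zeta x t)\<^sup>2) (at t within S)"
proof -
  have "((\<lambda>t. psi x t) has_real_derivative - 2 * real CARD('n)) (at t within S)"
    unfolding psi_def by (auto intro!: derivative_eq_intros)
  from DERIV_chain2[OF max_cube_has_real_derivative this]
  show ?thesis by (simp add: zeta_def ac_simps)
qed

lemma coef_x:
  assumes "x \<in> \<Omega>" "t \<in> {0<..<T}"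
  shows "((\<lambda>y. coef y t) has_derivative coef' x t) (at x)"
proof -
  have t: "t \<in> {0..T}" using assms by auto
  show ?thesis
    unfolding coef_def coef'_def[abs_def]
    by (auto intro!: derivative_eq_intros psi_x q_x[OF assms] p_x[OF assms(1) t] u_x[OF assms(1) t]
        simp: algebra_simps)
qed

lemma flux_x:
  assumes "x \<in> \<Omega>" "t \<in> {0<..<T}"
  shows "((\<lambda>y. flux y t) has_derivative flux' x t) (at x)"
proof -
  have t: "t \<in> {0..T}" using assms by auto
  note p = p_x[OF assms(1) t]
  show ?thesis
    unfolding flux_def
    by (rule has_derivative_eq_rhs[OF has_derivative_diff[OF
          has_derivative_scaleR[OF coef_x[OF assms] divergence_unit_normal(1)[OF p W_def]]
          has_derivative_scaleR[OF has_derivative_mult_right[OF has_derivative_area(1)[OF p W_def]]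
            has_derivative_ident]]])
      (simp add: flux'_def fun_eq_iff)
qed

lemma field_x:
  assumes "x \<in> \<Omega>" "t \<in> {0<..<T}"
  shows "((\<lambda>y. (zeta y t)\<^sup>2 *\<^sub>R flux y t) has_derivative field' x t) (at x)"
  by (rule has_derivative_eq_rhs[OF has_derivative_scaleR[OF zeta_square_x flux_x[OF assms]]])
    (simp add: field'_def fun_eq_iff)

text \<open>The flow equation replaces \<open>div (du / W)\<close> by \<open>u_t / W\<close>.
  Symmetry of the Hessian brings \<open>p \<bullet> (P *v x)\<close> into the form
  \<open>x \<bullet> (P *v p)\<close>, in which it cancels against the Hessian term of
  \<open>coef'\<close>.\<close>

lemma field_divergence:
  assumes "x \<in> \<Omega>" "t \<in> {0<..<T}"
  shows "(\<Sum>i\<in>UNIV. field' x t (axis i 1) $ i) =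
    (zeta x t)\<^sup>2 * (coef x t * (q x t / W x t) + coef' x t (p x t) / W x t
      - 6 * t\<^sup>2 * (real CARD('n) * W x t + (x \<bullet> (P x t *v p x t)) / W x t))
    - 4 * zeta x t * (coef x t * ((x \<bullet> p x t) / W x t) - 6 * t\<^sup>2 * W x t * (x \<bullet> x))"
proof -
  have t: "t \<in> {0..T}" using assms by auto
  let ?N' = "\<lambda>i. (1 / W x t) *\<^sub>R (P x t *v axis i 1) - ((p x t \<bullet> (P x t *v axis i 1)) / (W x t)^3) *\<^sub>R p x t"
  have 1: "(\<Sum>i\<in>UNIV. ?N' i $ i) = q x t / W x t"
    using divergence_unit_normal(2)[OF p_x[OF assms(1) t] W_def] evolution[OF assms(1) t] by simp
  have 2: "(\<Sum>i\<in>UNIV. coef' x t (axis i 1) * p x t $ i) = coef' x t (p x t)"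
    by (rule linear_sum_components[OF has_derivative_linear[OF coef_x[OF assms]]])
  have "linear (\<lambda>h. p x t \<bullet> (P x t *v h))"
    by (auto simp: linear_iff inner_add_right matrix_vector_right_distrib matrix_vector_mult_scaleR)
  from linear_sum_components[OF this, of x]
  have 3: "(\<Sum>i\<in>UNIV. (p x t \<bullet> (P x t *v axis i 1)) * x $ i) = x \<bullet> (P x t *v p x t)"
    using P_sym[OF assms] dot_lmul_matrix[of "p x t" "P x t" x]
    by (metis inner_commute transpose_matrix_vector)
  have 4: "(\<Sum>i\<in>UNIV. (x \<bullet> axis i 1) * v $ i) = x \<bullet> v" for v
    by (intro linear_sum_components) (simp add: linear_iff inner_add_right)
  have A: "(\<Sum>i\<in>UNIV. flux' x t (axis i 1) $ i) = coef x t * (\<Sum>i\<in>UNIV. ?N' i $ i)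
      + (\<Sum>i\<in>UNIV. coef' x t (axis i 1) * p x t $ i) / W x t
      - 6 * t\<^sup>2 * (real CARD('n) * W x t + (\<Sum>i\<in>UNIV. (p x t \<bullet> (P x t *v axis i 1)) * x $ i) / W x t)"
    unfolding flux'_def
    by (simp add: sum.distrib sum_subtractf sum_distrib_left sum_divide_distrib algebra_simps)
  have B: "(\<Sum>i\<in>UNIV. field' x t (axis i 1) $ i) = (zeta x t)\<^sup>2 * (\<Sum>i\<in>UNIV. flux' x t (axis i 1) $ i)
      - 4 * zeta x t * (\<Sum>i\<in>UNIV. (x \<bullet> axis i 1) * flux x t $ i)"
    unfolding field'_def by (simp add: sum_subtractf sum_distrib_left mult.assoc)
  show ?thesis
    unfolding B A 1 2 3 4 by (simp add: flux_def inner_diff_right algebra_simps)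
qed

lemma density_t:
  assumes "x \<in> \<Omega>" "t \<in> {0..T}"
  shows "((\<lambda>\<tau>. density x \<tau>) has_real_derivative density_t x t) (at t within {0..T})"
proof -
  have "1 + p x t \<bullet> p x t > 0" by (simp add: add_pos_nonneg)
  moreover have "((\<lambda>\<tau>. p x \<tau> \<bullet> p x \<tau>) has_real_derivative 2 * (s x t \<bullet> p x t)) (at t within {0..T})"
    unfolding has_field_derivative_def
    by (rule has_derivative_eq_rhs[OF has_derivative_inner[OF
          p_t[OF assms, unfolded has_vector_derivative_def]
          p_t[OF assms, unfolded has_vector_derivative_def]]])
      (simp add: fun_eq_iff inner_commute)
  ultimately have W: "((\<lambda>\<tau>. W x \<tau>) has_real_derivative (s x t \<bullet> p x t) / W x t) (at t within {0..T})"
    unfolding W_def by (auto intro!: derivative_eq_intros simp: field_simps)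
  have "((\<lambda>\<tau>. \<tau>\<^sup>2) has_real_derivative 2 * t) (at t within {0..T})"
    by (auto intro!: derivative_eq_intros)
  from DERIV_mult[OF DERIV_mult[OF this zeta_cube_t[of x]] W] show ?thesis
    unfolding density_def density_t_def
    by (rule DERIV_cong) (simp add: algebra_simps)
qed

text \<open>Where \<open>zeta\<close> vanishes, so does the left-hand side. Elsewhere
  \<open>psi = zeta\<close>, the height bound is available, and the algebraic inequality applies
  with Cauchy-Schwarz for \<open>x\<close> and \<open>du\<close>.\<close>

lemma density_inequality:
  assumes "x \<in> \<Omega>" "t \<in> {0<..<T}"
  shows "density_t x t - (\<Sum>i\<in>UNIV. field' x t (axis i 1) $ i) \<le> 2 * T * \<rho>^6 + 12 * T * N * \<rho>^5 + N\<^sup>2 * \<rho>^6"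
proof (cases "zeta x t = 0")
  case True
  then show ?thesis
    using T_pos \<rho> N_nonneg by (simp add: density_t_def field_divergence[OF assms])
next
  case False
  then have psi: "psi x t = zeta x t" "0 < zeta x t"
    by (auto simp: zeta_def max_def split: if_splits)
  have nt: "0 \<le> 2 * real CARD('n) * t" using assms by simp
  have "\<bar>u x t\<bar> \<le> N"
    using psi assms by (intro height) (auto simp: psi_def)
  moreover have "zeta x t \<le> \<rho>\<^sup>2" "x \<bullet> x \<le> \<rho>\<^sup>2"
    using psi(2) nt inner_ge_zero[of x] unfolding psi(1)[symmetric] psi_def by linarith+
  moreover have "(x \<bullet> p x t)\<^sup>2 \<le> (x \<bullet> x) * (p x t \<bullet> p x t)"
    by (rule Cauchy_Schwarz_ineq)
  ultimately show ?thesis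
    using localized_area_inequality[of "W x t" "p x t \<bullet> p x t" "zeta x t" \<rho> t T "u x t" N "x \<bullet> x" "x \<bullet> p x t"
        "real CARD('n)" "s x t \<bullet> p x t" "q x t" "x \<bullet> (P x t *v p x t)"]
      W_pos W_square psi assms \<rho>
    by (simp add: density_t_def field_divergence[OF assms] coef_def coef'_def)
qed

lemma field'_cont:
  assumes "t \<in> {0..T}"
  shows "continuous_on \<Omega> (\<lambda>x. field' x t h $ i)"
proof -
  have "continuous_on \<Omega> (\<lambda>x. P x t *v h)"
    unfolding matrix_vector_mult_def
    by (intro continuous_intros continuous_on_slice[OF P_cont] assms)
  then show ?thesis
    unfolding field'_def flux'_def flux_def coef_def coef'_def W_def psi_def zeta_def
    using continuous_on_slice[OF u_cont assms] continuous_on_slice[OF p_cont assms]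
      continuous_on_slice[OF q_cont assms] continuous_on_slice[OF s_cont assms]
    by (intro continuous_intros) (auto simp: add_pos_nonneg less_imp_neq[symmetric] add_nonneg_eq_0_iff)
qed

lemma density_cont:
  "continuous_on (\<Omega> \<times> {0..T}) (\<lambda>(x, t). density x t)"
  "continuous_on (\<Omega> \<times> {0..T}) (\<lambda>(x, t). density_t x t)"
proof -
  have *: "1 + v \<bullet> v \<noteq> 0" for v :: "real^'n" by (smt (verit) inner_ge_zero)
  show "continuous_on (\<Omega> \<times> {0..T}) (\<lambda>(x, t). density x t)"
    "continuous_on (\<Omega> \<times> {0..T}) (\<lambda>(x, t). density_t x t)"
    using p_cont s_cont
    unfolding density_def density_t_def W_def psi_def zeta_def split_beta
    by (intro continuous_intros; auto simp: *)+
qed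

abbreviation box :: "(real^'n) set" where "box \<equiv> cbox (\<chi> i. - \<rho>) (\<chi> i. \<rho>)"

lemma cball_subset_box: "cball 0 \<rho> \<subseteq> box"
proof
  fix x :: "real^'n"
  assume "x \<in> cball 0 \<rho>"
  then have "\<bar>x $ i\<bar> \<le> \<rho>" for i
    using component_le_norm_cart[of x i] by simp
  then show "x \<in> box"
    by (simp add: mem_box_cart abs_le_iff) (smt (verit))
qed

text \<open>The factor \<open>zeta^2\<close> is continuously differentiable across the edge of its
  support, so the field extended by zero has continuous directional derivatives; each diagonal term
  then integrates to 0.\<close>

lemma integral_divergence_zero:
  assumes t: "t \<in> {0<..<T}"
  shows "((\<lambda>x. if x \<in> \<Omega> then \<Sum>i\<in>UNIV. field' x t (axis i 1) $ i else 0) has_integral 0) box"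
proof -
  have t': "t \<in> {0..T}" using t by auto
  define f where "f i x = (if x \<in> \<Omega> then ((zeta x t)\<^sup>2 *\<^sub>R flux x t) $ i else 0)" for i x
  define D where "D i x = (if x \<in> \<Omega> then field' x t (axis i 1) $ i else 0)" for i x
  have ext: "continuous_on UNIV (\<lambda>x. if x \<in> \<Omega> then g x else 0)"
    if "continuous_on \<Omega> g" "\<And>x. x \<in> \<Omega> \<Longrightarrow> x \<notin> cball 0 \<rho> \<Longrightarrow> g x = 0" for g :: "real^'n \<Rightarrow> real"
  proof -
    have "continuous_on (\<Omega> \<times> {t}) (\<lambda>(x, t). g x)"
      unfolding split_beta by (intro continuous_on_compose2[OF that(1)] continuous_intros) auto
    from zero_extension_continuous[OF open_domain closed_cball cball_sub this that(2)]
    have "continuous_on (UNIV \<times> {t}) (\<lambda>(x, t). if x \<in> \<Omega> then g x else 0)" .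
    from continuous_on_slice[OF this] show ?thesis by simp
  qed
  have out: "zeta x t = 0" if "x \<notin> cball 0 \<rho>" for x
    using zeta_outside that t by simp
  have D_cont: "continuous_on UNIV (D i)" for i
    unfolding D_def by (intro ext field'_cont t') (simp add: field'_def out)
  have "integral box (D i) = 0" for i
  proof (rule integral_directional_derivative_zero[where f="f i" and v="axis i 1"])
    show "continuous_on UNIV (D i)" by (rule D_cont)
    have "continuous_on \<Omega> (\<lambda>x. (zeta x t)\<^sup>2 *\<^sub>R flux x t)"
      by (rule has_derivative_continuous_on[OF has_derivative_at_withinI[OF field_x[OF _ t]]])
    then have "continuous_on \<Omega> (\<lambda>x. ((zeta x t)\<^sup>2 *\<^sub>R flux x t) $ i)"
      by (rule continuous_on_component)
    then show "continuous_on UNIV (f i)"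
      unfolding f_def by (intro ext) (simp_all add: out)
    show "f i x = 0" "D i x = 0" if "x \<notin> box" for x
    proof -
      have "zeta x t = 0" using out[of x] cball_subset_box that by blast
      then show "f i x = 0" "D i x = 0" by (simp_all add: f_def D_def field'_def)
    qed
    show "((\<lambda>r. f i (x + r *\<^sub>R axis i 1)) has_real_derivative D i x) (at 0)" for x
    proof -
      have "(f i has_derivative (\<lambda>h. if x \<in> \<Omega> then field' x t h $ i else 0)) (at x)"
      proof (cases "x \<in> \<Omega>")
        case True
        have "((\<lambda>x. ((zeta x t)\<^sup>2 *\<^sub>R flux x t) $ i) has_derivative (\<lambda>h. field' x t h $ i)) (at x)"
          by (intro bounded_linear.has_derivative[OF bounded_linear_vec_nth] field_x True t)
        from has_derivative_transform_within_open[OF this open_domain True, of "f i"]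
        show ?thesis using True by (simp add: f_def)
      next
        case False
        have "((\<lambda>x. 0) has_derivative (\<lambda>h. 0::real)) (at x)" by simp
        \<comment> \<open>A point outside \<Omega> has this open neighbourhood, on which the
          extended field is identically 0.\<close>
        moreover have "open (- cball (0::real^'n) \<rho>)" by auto
        moreover have "x \<in> - cball 0 \<rho>" using False cball_sub by blast
        ultimately have "(f i has_derivative (\<lambda>h. 0)) (at x)"
          by (rule has_derivative_transform_within_open) (simp add: f_def out)
        then show ?thesis using False by simp
      qed
      then have "((\<lambda>r. f i (x + r *\<^sub>R axis i 1)) has_derivative
          (\<lambda>r. if x \<in> \<Omega> then field' x t (r *\<^sub>R axis i 1) $ i else 0)) (at 0)"
        by (intro has_derivative_compose[of "\<lambda>r. x + r *\<^sub>R axis i 1" "\<lambda>r. r *\<^sub>R axis i 1" 0 UNIV "f i"])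
          (auto intro!: derivative_eq_intros)
      moreover have "field' x t (r *\<^sub>R axis i 1) = r *\<^sub>R field' x t (axis i 1)" if "x \<in> \<Omega>" for r
        using linear_scale[OF has_derivative_linear[OF field_x[OF that t]]] .
      ultimately show ?thesis
        by (auto simp: has_field_derivative_def D_def mult.commute elim!: has_derivative_eq_rhs)
    qed
  qed
  then have "(D i has_integral 0) box" for i
    using integrable_integral[OF integrable_continuous[OF continuous_on_subset[OF D_cont[of i]]], of "\<chi> i. - \<rho>" "\<chi> i. \<rho>"]
    by simp
  then have "((\<lambda>x. \<Sum>i\<in>UNIV. D i x) has_integral (\<Sum>i\<in>(UNIV::'n set). 0)) box"
    by (intro has_integral_sum) auto
  moreover have "(\<Sum>i\<in>UNIV. D i x) = (if x \<in> \<Omega> then \<Sum>i\<in>UNIV. field' x t (axis i 1) $ i else 0)" for x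
    by (simp add: D_def)
  ultimately show ?thesis by simp
qed

text \<open>Subtracting a divergence of integral 0 bounds \<open>I'\<close> at interior times by
  \<open>B\<close> times the volume of the cube; the mean value theorem then bounds
  \<open>I T - I 0\<close>.\<close>

lemma weighted_area_bound:
  "integral box (\<lambda>x. if x \<in> \<Omega> then density x T else 0)
    \<le> T * (2 * T * \<rho>^6 + 12 * T * N * \<rho>^5 + N\<^sup>2 * \<rho>^6) * (2 * \<rho>) ^ CARD('n)"
proof -
  define B where "B = 2 * T * \<rho>^6 + 12 * T * N * \<rho>^5 + N\<^sup>2 * \<rho>^6"
  have B: "0 \<le> B" using T_pos \<rho> N_nonneg by (simp add: B_def)
  define G where "G x t = (if x \<in> \<Omega> then density x t else 0)" for x t
  define G' where "G' x t = (if x \<in> \<Omega> then density_t x t else 0)" for x t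
  define I where "I t = integral box (\<lambda>x. G x t)" for t
  note ext = zero_extension_continuous[OF open_domain closed_cball cball_sub]
  have G_cont: "continuous_on (UNIV \<times> {0..T}) (\<lambda>(x, t). G x t)"
    unfolding G_def by (rule ext[OF density_cont(1)]) (simp add: density_def zeta_outside)
  have G'_cont: "continuous_on (UNIV \<times> {0..T}) (\<lambda>(x, t). G' x t)"
    unfolding G'_def by (rule ext[OF density_cont(2)]) (simp add: density_t_def zeta_outside)
  have slice: "(\<lambda>x. g x t) integrable_on box"
    if "continuous_on (UNIV \<times> {0..T}) (\<lambda>(x, t). g x t)" "t \<in> {0..T}" for g :: "real^'n \<Rightarrow> real \<Rightarrow> real" and t
    by (intro integrable_continuous continuous_on_subset[OF continuous_on_slice[OF that]]) auto
  have I: "(I has_real_derivative integral box (\<lambda>x. G' x t)) (at t within {0..T})" if "t \<in> {0..T}" for t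
    unfolding I_def
  proof (rule leibniz_rule_field_derivative)
    show "((\<lambda>t. G x t) has_real_derivative G' x t) (at t within {0..T})" if "t \<in> {0..T}" for t x
      using density_t[OF _ that, of x] by (simp add: G_def G'_def)
    show "(\<lambda>x. G x t) integrable_on box" if "t \<in> {0..T}" for t
      by (rule slice[OF G_cont that])
    show "continuous_on ({0..T} \<times> box) (\<lambda>(t, x). G' x t)"
    proof -
      have swap: "continuous_on ({0..T} \<times> box) (\<lambda>z. (snd z, fst z))"
        by (intro continuous_intros)
      have "(\<lambda>z. (snd z, fst z)) ` ({0..T} \<times> box) \<subseteq> UNIV \<times> {0..T}" by auto
      from continuous_on_compose2[OF G'_cont swap this] show ?thesis
        by (simp add: split_beta)
    qed
  qed (use that in auto)
  have I'_le: "integral box (\<lambda>x. G' x t) \<le> B * (2 * \<rho>) ^ CARD('n)" if t: "t \<in> {0<..<T}" for t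
  proof -
    let ?d = "\<lambda>x. if x \<in> \<Omega> then \<Sum>i\<in>UNIV. field' x t (axis i 1) $ i else 0"
    have "((\<lambda>x. G' x t) has_integral integral box (\<lambda>x. G' x t)) box"
      using slice[OF G'_cont, of t] t by (intro integrable_integral) auto
    from has_integral_diff[OF this integral_divergence_zero[OF t]]
    have "((\<lambda>x. G' x t - ?d x) has_integral integral box (\<lambda>x. G' x t)) box" by simp
    moreover have "((\<lambda>x. B) has_integral B * (2 * \<rho>) ^ CARD('n)) box"
    proof -
      have "box \<noteq> {}" using \<rho> by (simp add: interval_ne_empty_cart)
      then have "measure lborel box = (2 * \<rho>) ^ CARD('n)" by (simp add: content_cbox_cart)
      then show ?thesis
        using has_integral_const[of B "\<chi> i. - \<rho>" "(\<chi> i. \<rho>) :: real^'n"] by (simp add: mult.commute)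
    qed
    moreover have "G' x t - ?d x \<le> B" for x
      using density_inequality[OF _ t, of x] B by (simp add: G'_def B_def)
    ultimately show ?thesis
      by (rule has_integral_le)
  qed
  have "continuous_on {0..T} I"
    by (rule DERIV_continuous_on[OF I])
  moreover have "(I has_derivative (*) (integral box (\<lambda>x. G' x t))) (at t)" if "0 < t" "t < T" for t
    using I[of t] that at_within_Icc_at[of 0 t T] by (simp add: has_field_derivative_def)
  ultimately obtain t where t: "0 < t" "t < T" "I T - I 0 = integral box (\<lambda>x. G' x t) * (T - 0)"
    using mvt[OF T_pos, of I "\<lambda>t. (*) (integral box (\<lambda>x. G' x t))"] by blast
  \<comment> \<open>The weight \<open>t^2\<close> removes the initial area from the
    estimate.\<close>
  have "I 0 = 0" by (simp add: I_def G_def density_def cong: if_cong)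
  then have "I T \<le> B * (2 * \<rho>) ^ CARD('n) * T"
    using t I'_le[of t] T_pos by (simp add: mult_right_mono)
  then show ?thesis by (simp add: I_def G_def B_def ac_simps)
qed

text \<open>On \<open>ball 0 a\<close> the cutoff at time \<open>T\<close> is at least
  \<open>c\<close>, so there the area element is at most \<open>density x T\<close> divided by
  \<open>T^2 c^3\<close>.\<close>

lemma area_bound:
  assumes a: "0 < a" and c: "c = \<rho>\<^sup>2 - a\<^sup>2 - 2 * real CARD('n) * T" "0 < c"
  shows "(\<integral>\<^sup>+x\<in>ball 0 a. ennreal (area_element (\<lambda>y. u y T) x) \<partial>lborel)
    \<le> ennreal ((2 * T * \<rho>^6 + 12 * T * N * \<rho>^5 + N\<^sup>2 * \<rho>^6) * (2 * \<rho>) ^ CARD('n) / (T * c^3))"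
proof -
  have T: "T \<in> {0..T}" using T_pos by simp
  define h where "h x = (if x \<in> \<Omega> then density x T else 0) / (T\<^sup>2 * c^3)" for x
  have "0 \<le> 2 * real CARD('n) * T" using T_pos by simp
  then have "a\<^sup>2 < \<rho>\<^sup>2" using c by linarith
  then have "a < \<rho>" using \<rho> by (simp add: power2_less_imp_less)
  then have ball: "ball 0 a \<subseteq> cball 0 \<rho>" by auto
  have "continuous_on UNIV (\<lambda>x. if x \<in> \<Omega> then density x T else 0)"
    by (rule continuous_on_slice[OF zero_extension_continuous[OF open_domain closed_cball cball_sub
          density_cont(1)] T])
      (simp add: density_def zeta_outside)
  then have "continuous_on UNIV h"
    unfolding h_def using T_pos c by (intro continuous_intros) auto
  moreover have "0 \<le> h x" for x
    using T_pos c W_pos[of x T] by (simp add: h_def density_def zeta_def)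
  moreover have "ball 0 a \<subseteq> box" using ball cball_subset_box by blast
  moreover have "area_element (\<lambda>y. u y T) x \<le> h x" if "x \<in> ball 0 a" for x
  proof -
    have x: "x \<in> \<Omega>" using that ball cball_sub by blast
    have "x \<bullet> x \<le> a\<^sup>2"
      using that power_mono[of "norm x" a 2] by (simp add: power2_norm_eq_inner)
    then have "c \<le> zeta x T" using c by (simp add: zeta_def psi_def)
    then have "c^3 \<le> (zeta x T)^3" using c by (intro power_mono) auto
    then have "T\<^sup>2 * c^3 * W x T \<le> density x T"
      using W_pos[of x T] by (simp add: density_def mult_left_mono mult_right_mono)
    moreover have "0 < T\<^sup>2 * c^3" using T_pos c by simp
    ultimately have "W x T \<le> h x"
      using x by (simp add: h_def pos_le_divide_eq mult.commute)
    then show ?thesis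
      using area_element_eqI[OF u_x[OF x T]] by (simp add: W_def)
  qed
  ultimately have "(\<integral>\<^sup>+x\<in>ball 0 a. ennreal (area_element (\<lambda>y. u y T) x) \<partial>lborel)
      \<le> ennreal (integral box h)"
    by (rule set_nn_integral_le_integral)
  also have "integral box h \<le> (2 * T * \<rho>^6 + 12 * T * N * \<rho>^5 + N\<^sup>2 * \<rho>^6) * (2 * \<rho>) ^ CARD('n) / (T * c^3)"
  proof -
    have "integral box h = integral box (\<lambda>x. if x \<in> \<Omega> then density x T else 0) / (T\<^sup>2 * c^3)"
      unfolding h_def by (rule integral_divide)
    also have "\<dots> \<le> T * (2 * T * \<rho>^6 + 12 * T * N * \<rho>^5 + N\<^sup>2 * \<rho>^6) * (2 * \<rho>) ^ CARD('n) / (T\<^sup>2 * c^3)"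
      using c T_pos by (intro divide_right_mono weighted_area_bound) auto
    also have "\<dots> = (2 * T * \<rho>^6 + 12 * T * N * \<rho>^5 + N\<^sup>2 * \<rho>^6) * (2 * \<rho>) ^ CARD('n) / (T * c^3)"
      using c T_pos by (simp add: power2_eq_square)
    finally show ?thesis .
  qed
  finally show ?thesis by (simp add: ennreal_leI)
qed

end

section \<open>Scaling and the final constant\<close>

text \<open>Take \<open>\<rho> = k r\<close>, \<open>a = r / 2\<close>, final time
  \<open>r^2\<close> and height bound \<open>M + K r\<close>. Then \<open>c = r^2 / 4\<close>, whose
  cube produces the factor 64.\<close>

lemma graph_area_bound:
  fixes u :: "real^'n \<Rightarrow> real \<Rightarrow> real"
  defines "k \<equiv> sqrt (2 * real CARD('n) + 1 / 2)" and "K \<equiv> sqrt (2 * real CARD('n) + 1)"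
  assumes r: "0 < r"
    and flow: "graph_flows_by_mean_curvature (ball 0 (K * r)) {0..r\<^sup>2} u"
    and init: "\<And>x. x \<in> ball 0 (K * r) \<Longrightarrow> \<bar>u x 0\<bar> \<le> M" and M: "0 \<le> M"
  shows "(\<integral>\<^sup>+x\<in>ball 0 (r / 2). ennreal (area_element (\<lambda>y. u y (r\<^sup>2)) x) \<partial>lborel)
    \<le> ennreal (64 * (2 * k) ^ CARD('n) * (2 * k^6 + 12 * k^5 * K + k^6 * K\<^sup>2) * r ^ CARD('n) * (1 + M / r)\<^sup>2)"
proof -
  have k: "k\<^sup>2 = 2 * real CARD('n) + 1 / 2" "0 < k" and K: "K\<^sup>2 = 2 * real CARD('n) + 1" "1 \<le> K"
    by (simp_all add: k_def K_def add_nonneg_pos)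
  have kK: "k < K" by (simp add: k_def K_def)
  obtain p q P s where "graph_flow (ball 0 (K * r)) (r\<^sup>2) u p q P s"
    using graph_flow_exists[OF flow] r by auto
  then interpret graph_flow "ball 0 (K * r)" "r\<^sup>2" u p q P s .
  have kr: "(k * r)\<^sup>2 = 2 * real CARD('n) * r\<^sup>2 + r\<^sup>2 / 2"
    by (simp add: power_mult_distrib k algebra_simps)
  interpret localized_graph_flow "ball 0 (K * r)" "r\<^sup>2" u p q P s "k * r" "M + K * r"
  proof
    show "0 < k * r" using k r by simp
    have "k * r < K * r" using kK r by simp
    then show "cball 0 (k * r) \<subseteq> ball (0::real^'n) (K * r)" by auto
    show "0 \<le> M + K * r" using M K r by simp
    fix x :: "real^'n" and t :: real
    assume "t \<in> {0..r\<^sup>2}" "x \<bullet> x + 2 * real CARD('n) * t < (k * r)\<^sup>2"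
    moreover have "(k * r)\<^sup>2 < (K * r)\<^sup>2"
      using \<open>k * r < K * r\<close> k r by (intro power_strict_mono) auto
    ultimately show "\<bar>u x t\<bar> \<le> M + K * r"
      using K r by (intro height_bound[OF refl init]) auto
  qed
  have c: "r\<^sup>2 / 4 = (k * r)\<^sup>2 - (r / 2)\<^sup>2 - 2 * real CARD('n) * r\<^sup>2"
    by (simp add: kr power_divide)
  \<comment> \<open>In terms of the scale-invariant height \<open>m\<close> all powers of
    \<open>r\<close> cancel except \<open>r^n\<close>.\<close>
  define m where "m = M / r"
  have m: "0 \<le> m" "M = m * r" using M r by (simp_all add: m_def)
  have "(2 * r\<^sup>2 * (k * r)^6 + 12 * r\<^sup>2 * (M + K * r) * (k * r)^5 + (M + K * r)\<^sup>2 * (k * r)^6)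
      * (2 * (k * r)) ^ CARD('n) / (r\<^sup>2 * (r\<^sup>2 / 4)^3)
    = 64 * (2 * k) ^ CARD('n) * (2 * k^6 + 12 * k^5 * (m + K) + k^6 * (m + K)\<^sup>2) * r ^ CARD('n)"
  proof -
    have "2 * r\<^sup>2 * (k * r)^6 + 12 * r\<^sup>2 * (M + K * r) * (k * r)^5 + (M + K * r)\<^sup>2 * (k * r)^6
        = (2 * k^6 + 12 * k^5 * (m + K) + k^6 * (m + K)\<^sup>2) * (r\<^sup>2 * (r\<^sup>2)^3)"
      unfolding m(2) by (simp add: algebra_simps power2_eq_square power_numeral_reduce)
    then show ?thesis
      using r by (simp add: power_mult_distrib power_divide)
  qed
  also have "\<dots> \<le> 64 * (2 * k) ^ CARD('n) * ((2 * k^6 + 12 * k^5 * K + k^6 * K\<^sup>2) * (1 + m)\<^sup>2) * r ^ CARD('n)"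
  proof -
    have 1: "1 \<le> (1 + m)\<^sup>2" and 2: "1 + m \<le> (1 + m)\<^sup>2"
      using m self_le_power[of "1 + m" 2] by (simp_all add: one_le_power)
    \<comment> \<open>\<open>K \<ge> 1\<close> lets the quadratic polynomial in \<open>m\<close> be
      absorbed into a multiple of \<open>(1 + m)^2\<close>.\<close>
    have mK: "m + K \<le> K * (1 + m)" using m K mult_right_mono[of 1 K m] by (simp add: algebra_simps)
    have "2 * k^6 * 1 \<le> 2 * k^6 * (1 + m)\<^sup>2" using 1 k by (intro mult_left_mono) auto
    moreover have "12 * k^5 * (m + K) \<le> 12 * k^5 * (K * (1 + m)\<^sup>2)"
      using order_trans[OF mK mult_left_mono[OF 2, of K]] k K by (intro mult_left_mono) auto
    moreover have "k^6 * (m + K)\<^sup>2 \<le> k^6 * (K\<^sup>2 * (1 + m)\<^sup>2)"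
      unfolding power_mult_distrib[symmetric]
      using mK m k K by (intro mult_left_mono power_mono) auto
    ultimately have "2 * k^6 + 12 * k^5 * (m + K) + k^6 * (m + K)\<^sup>2
        \<le> (2 * k^6 + 12 * k^5 * K + k^6 * K\<^sup>2) * (1 + m)\<^sup>2"
      unfolding distrib_right mult.assoc by linarith
    then show ?thesis
      using k r by (intro mult_right_mono mult_left_mono) auto
  qed
  finally have "(2 * r\<^sup>2 * (k * r)^6 + 12 * r\<^sup>2 * (M + K * r) * (k * r)^5 + (M + K * r)\<^sup>2 * (k * r)^6)
      * (2 * (k * r)) ^ CARD('n) / (r\<^sup>2 * (r\<^sup>2 / 4)^3)
    \<le> 64 * (2 * k) ^ CARD('n) * (2 * k^6 + 12 * k^5 * K + k^6 * K\<^sup>2) * r ^ CARD('n) * (1 + M / r)\<^sup>2"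
    by (simp add: m_def ac_simps)
  from order_trans[OF area_bound[OF _ c] ennreal_leI[OF this]] show ?thesis
    using r by simp
qed

theorem theorem2:
  shows "\<exists>C::real. \<forall>r>0. \<forall>u :: real ^ 'n \<Rightarrow> real \<Rightarrow> real.
    graph_flows_by_mean_curvature (ball 0 (sqrt (2 * real CARD('n) + 1) * r)) {0..r\<^sup>2} u \<longrightarrow>
    (\<integral>\<^sup>+ x \<in> ball 0 (r / 2). ennreal (area_element (\<lambda>y. u y (r\<^sup>2)) x) \<partial>lborel)
      \<le> ennreal C * ennreal (r ^ CARD('n)) *
         (1 + ennreal (1 / r) *
            sup_norm_on (ball 0 (sqrt (2 * real CARD('n) + 1) * r)) (\<lambda>x. u x 0))\<^sup>2"
proof -
  define k where "k = sqrt (2 * real CARD('n) + 1 / 2)"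
  define K where "K = sqrt (2 * real CARD('n) + 1)"
  define C where "C = 64 * (2 * k) ^ CARD('n) * (2 * k^6 + 12 * k^5 * K + k^6 * K\<^sup>2)"
  \<comment> \<open>Strict positivity makes the right-hand side infinite when the sup norm is
    infinite, since \<open>0 * top = 0\<close> in \<open>ennreal\<close>.\<close>
  have C: "0 < C"
    unfolding C_def k_def K_def
    by (intro mult_pos_pos add_pos_nonneg zero_less_power) (simp_all add: add_nonneg_pos)
  show ?thesis
  proof (intro exI[of _ C] allI impI)
    fix r :: real and u :: "real^'n \<Rightarrow> real \<Rightarrow> real"
    assume r: "0 < r"
      and flow: "graph_flows_by_mean_curvature (ball 0 (sqrt (2 * real CARD('n) + 1) * r)) {0..r\<^sup>2} u"
    let ?B = "ball (0::real^'n) (sqrt (2 * real CARD('n) + 1) * r)"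
    let ?S = "sup_norm_on ?B (\<lambda>x. u x 0)"
    let ?A = "\<integral>\<^sup>+ x \<in> ball 0 (r / 2). ennreal (area_element (\<lambda>y. u y (r\<^sup>2)) x) \<partial>lborel"
    show "?A \<le> ennreal C * ennreal (r ^ CARD('n)) * (1 + ennreal (1 / r) * ?S)\<^sup>2"
    proof (cases ?S)
      case (real M)
      have "\<bar>u x 0\<bar> \<le> M" if "x \<in> ?B" for x
      proof -
        have "ennreal \<bar>u x 0\<bar> \<le> ennreal M"
          using SUP_upper[OF that, of "\<lambda>x. ennreal \<bar>u x 0\<bar>"] real by (simp add: sup_norm_on_def)
        then show ?thesis using real by simp
      qed
      from graph_area_bound[OF r flow this] have "?A \<le> ennreal (C * r ^ CARD('n) * (1 + M / r)\<^sup>2)"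
        using real by (simp add: C_def k_def K_def)
      also have "\<dots> = ennreal C * ennreal (r ^ CARD('n)) * (ennreal (1 + M / r))\<^sup>2"
        using real r C by (simp add: ennreal_mult ennreal_power del: ennreal_plus)
      also have "ennreal (1 + M / r) = 1 + ennreal (1 / r) * ?S"
        using real r ennreal_plus[of 1 "M / r"] by (simp flip: ennreal_mult)
      finally show ?thesis .
    next
      case top
      then show ?thesis
        using r C by (simp add: ennreal_mult_eq_top_iff power2_eq_square ennreal_mult_top ennreal_top_mult)
    qed
  qed
qed

end
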